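(* Let $G$ be an oriented graph with finite non-empty vertex set $I$. 1. The following conditions are equivalent: (a) The family $(P_i(n))_{i\in I,n\ge1}$ is a basis of $A_G$. (b) All the $P_i(n)$, $i\in I$, $n\ge1$, are non-zero. (c) Any vertex of $G$ has a direct descendant, and if two vertices of $G$ have a common direct ascendant, then they have the same direct descendants. (d) The SDSE associated to the (non-constant) formal series $F_i=1+\sum_{i\to j}h_j$, $i\in I$, is Hopf. 2. If this holds, then $A_G$ is generated by $P_i(1)$, $i\in I$, and the relations: - if $j$ is not a direct descendant of $i$ in $G$, $P_j(1)P_i(1)=0$; - if $i\to j$ and $i\to k$ in $G$, then $P_j(1)P_i(1)=P_k(1)P_i(1)$. The product of $A_G$ is given by $$P_j(n)P_i(m)=\begin{cases}P_i(m+n)&\text{if there is an oriented path of length } m \text{ from } i \text{ to } j \text{ in } G,\\0&\text{otherwise.}\end{cases}$$ Moreover, if $(S)$ is the system of condition (d), the pre-Lie algebra $\mathfrak g_{(S)}$ is associative and isomorphic to $A_G$.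
   Context: Oriented graphs may have loops, and have at most one edge from $i$ to $j$. $i\to j$ means there is an edge from $i$ to $j$; then $j$ is a direct descendant of $i$ and $i$ a direct ascendant of $j$. $K$ is a field of characteristic zero. $A_G$ is the associative non-unitary $K$-algebra generated by elements $P_i(1)$, $i\in I$, with relations: $P_j(1)P_i(1)=0$ if $j$ is not a direct descendant of $i$; and $P_{i_n}(1)\cdots P_{i_2}(1)P_{i_1}(1)=P_{i'_n}(1)\cdots P_{i'_2}(1)P_{i_1}(1)$ whenever $i_1\to i_2\to\cdots\to i_n$ and $i_1\to i'_2\to\cdots\to i'_n$ in $G$. For $i\in I$, $n\ge1$: $P_i(n)=P_{i_n}(1)\cdots P_{i_2}(1)P_i(1)$ for any oriented path $i\to i_2\to\cdots\to i_n$ in $G$ (independent of the path), and $P_i(n)=0$ if no such path exists. SDSE. $\mathcal H_I$ is the (Connes-Kreimer) polynomial algebra generated by the (isomorphism classes of non-planar) rooted trees with vertices decorated by $I$, graded by the number of vertices, with completion $\widehat{\mathcal H_I}=\prod_n\mathcal H_I(n)$. Its coproduct is the algebra morphism with $\Delta(t)=t\otimes1+1\otimes t+\sum_cP^c(t)\otimes R^c(t)$ for each tree $t$, where $c$ runs over non-empty sets of edges such that every path from the root to a leaf meets at most one edge of $c$; after deleting the edges of $c$, $R^c(t)$ is the component of the root and $P^c(t)$ the product of the other components. $B_i^+$ grafts the trees of a forest on a common root decorated by $i$. The SDSE $(S)$ associated to non-constant series $F_i\in K[[h_j,j\in I]]$ is the system $X_i=B_i^+(F_i(X_j,j\in I))$,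 $i\in I$, which has a unique solution in $\widehat{\mathcal H_I}^{\,I}$; $X_i(n)$ is the degree $n$ component of $X_i$ and $\mathcal H_{(S)}$ the subalgebra generated by the $X_i(n)$. $(S)$ is Hopf if $\mathcal H_{(S)}$ is a Hopf subalgebra of $\mathcal H_I$. For a Hopf SDSE, $\mathfrak g_{(S)}=\mathrm{Prim}(\mathcal H_{(S)}^* )$ is the Lie algebra of primitive elements of the graded dual of $\mathcal H_{(S)}$. It carries a pre-Lie product $\star$ (inducing its bracket): $f\star g$ is the unique element of $\mathfrak g_{(S)}$ such that $(f\star g)(x)=(f\otimes g)\circ(\pi\otimes\pi)\circ\Delta(x)$ for all $x\in\mathrm{Vect}(X_i(n):i\in I,n\ge1)$, where $\pi$ is the projection of $\mathcal H_I$ on the span of trees vanishing on forests that are not trees. *)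

theory Defs
  imports
    "HOL-Library.Poly_Mapping"
    "HOL-Library.Multiset"
    "HOL-Library.Product_Plus"
    "HOL-Library.Sublist"
    "HOL-Computational_Algebra.Formal_Power_Series"
begin

section \<open>Non-unitary algebras given by a carrier\<close>

text \<open>
  The algebras \<open>A\<^sub>G\<close> and \<open>\<gg>\<^sub>(\<^sub>S\<^sub>)\<close> depend on term parameters, hence are carriers with operations rather
  than types. The product is a priori neither unital nor associative.
\<close>

record ('k, 'a) nalg =
  elems :: "'a set"
  zeroA :: 'a
  addA :: "'a \<Rightarrow> 'a \<Rightarrow> 'a"
  scaleA :: "'k \<Rightarrow> 'a \<Rightarrow> 'a"
  multA :: "'a \<Rightarrow> 'a \<Rightarrow> 'a"

definition nu_algebra :: "('k::field, 'a) nalg \<Rightarrow> bool" where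
  "nu_algebra A \<longleftrightarrow>
     zeroA A \<in> elems A \<and>
     (\<forall>x\<in>elems A. \<forall>y\<in>elems A. addA A x y \<in> elems A \<and> multA A x y \<in> elems A) \<and>
     (\<forall>c. \<forall>x\<in>elems A. scaleA A c x \<in> elems A) \<and>
     (\<forall>x\<in>elems A. \<forall>y\<in>elems A. \<forall>z\<in>elems A. addA A (addA A x y) z = addA A x (addA A y z)) \<and>
     (\<forall>x\<in>elems A. \<forall>y\<in>elems A. addA A x y = addA A y x) \<and>
     (\<forall>x\<in>elems A. addA A (zeroA A) x = x) \<and>
     (\<forall>x\<in>elems A. \<exists>y\<in>elems A. addA A x y = zeroA A) \<and>
     (\<forall>x\<in>elems A. scaleA A 1 x = x) \<and>
     (\<forall>c d. \<forall>x\<in>elems A. scaleA A c (scaleA A d x) = scaleA A (c * d) x) \<and>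
     (\<forall>c d. \<forall>x\<in>elems A. scaleA A (c + d) x = addA A (scaleA A c x) (scaleA A d x)) \<and>
     (\<forall>c. \<forall>x\<in>elems A. \<forall>y\<in>elems A. scaleA A c (addA A x y) = addA A (scaleA A c x) (scaleA A c y)) \<and>
     (\<forall>x\<in>elems A. \<forall>y\<in>elems A. \<forall>z\<in>elems A.
        multA A (addA A x y) z = addA A (multA A x z) (multA A y z) \<and>
        multA A z (addA A x y) = addA A (multA A z x) (multA A z y)) \<and>
     (\<forall>c. \<forall>x\<in>elems A. \<forall>y\<in>elems A.
        multA A (scaleA A c x) y = scaleA A c (multA A x y) \<and>
        multA A x (scaleA A c y) = scaleA A c (multA A x y))"

definition associative_alg :: "('k, 'a) nalg \<Rightarrow> bool" where
  "associative_alg A \<longleftrightarrow>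
     (\<forall>x\<in>elems A. \<forall>y\<in>elems A. \<forall>z\<in>elems A. multA A (multA A x y) z = multA A x (multA A y z))"

definition isomorphic_alg :: "('k, 'a) nalg \<Rightarrow> ('k, 'b) nalg \<Rightarrow> bool" where
  "isomorphic_alg A B \<longleftrightarrow>
     (\<exists>\<phi>. bij_betw \<phi> (elems A) (elems B) \<and>
        (\<forall>x\<in>elems A. \<forall>y\<in>elems A. \<phi> (addA A x y) = addA B (\<phi> x) (\<phi> y)) \<and>
        (\<forall>c. \<forall>x\<in>elems A. \<phi> (scaleA A c x) = scaleA B c (\<phi> x)) \<and>
        (\<forall>x\<in>elems A. \<forall>y\<in>elems A. \<phi> (multA A x y) = multA B (\<phi> x) (\<phi> y)))"

text \<open>The sum of \<open>c j \<cdot> v j\<close> over the entries \<open>j\<close> of a list.\<close>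

definition lincomb :: "('k, 'a) nalg \<Rightarrow> ('j \<Rightarrow> 'k) \<Rightarrow> ('j \<Rightarrow> 'a) \<Rightarrow> 'j list \<Rightarrow> 'a" where
  "lincomb A c v js = foldr (\<lambda>j s. addA A (scaleA A (c j) (v j)) s) js (zeroA A)"

definition is_basis :: "('k::zero, 'a) nalg \<Rightarrow> 'j set \<Rightarrow> ('j \<Rightarrow> 'a) \<Rightarrow> bool" where
  "is_basis A J v \<longleftrightarrow>
     (\<forall>j\<in>J. v j \<in> elems A) \<and>
     (\<forall>x\<in>elems A. \<exists>js c. distinct js \<and> set js \<subseteq> J \<and> x = lincomb A c v js) \<and>
     (\<forall>js c. distinct js \<and> set js \<subseteq> J \<and> lincomb A c v js = zeroA A \<longrightarrow> (\<forall>j\<in>set js. c j = 0))"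


section \<open>Free vector spaces\<close>

text \<open>
  Elements of \<open>'a \<Rightarrow>\<^sub>0 'k\<close> are formal linear combinations of elements of \<open>'a\<close>.
  If \<open>'a\<close> is a monoid, the library product on this type is that of the monoid algebra.
\<close>

definition smul :: "'k::field \<Rightarrow> ('a \<Rightarrow>\<^sub>0 'k) \<Rightarrow> ('a \<Rightarrow>\<^sub>0 'k)" where
  "smul c x = Poly_Mapping.map ((*) c) x"

lemma lookup_smul [simp]: "Poly_Mapping.lookup (smul c x) a = c * Poly_Mapping.lookup x a"
  by (simp add: smul_def Poly_Mapping.map.rep_eq when_def)

lemma vector_space_smul: "vector_space smul"
  by unfold_locales (auto intro!: poly_mapping_eqI simp: lookup_add algebra_simps)

abbreviation basis_vec :: "'a \<Rightarrow> ('a \<Rightarrow>\<^sub>0 'k::field)" where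
  "basis_vec a \<equiv> Poly_Mapping.single a 1"

definition lin_ext :: "('a \<Rightarrow> ('b \<Rightarrow>\<^sub>0 'k::field)) \<Rightarrow> ('a \<Rightarrow>\<^sub>0 'k) \<Rightarrow> ('b \<Rightarrow>\<^sub>0 'k)" where
  "lin_ext \<phi> x = (\<Sum>a\<in>Poly_Mapping.keys x. smul (Poly_Mapping.lookup x a) (\<phi> a))"

text \<open>
  The tensor product of two free vector spaces is the free vector space on pairs. For monoid
  algebras, its monoid algebra structure over the product monoid is the tensor product algebra.
\<close>

definition tensor :: "('a \<Rightarrow>\<^sub>0 'k::field) \<Rightarrow> ('b \<Rightarrow>\<^sub>0 'k) \<Rightarrow> ('a \<times> 'b \<Rightarrow>\<^sub>0 'k)" where
  "tensor x y = (\<Sum>a\<in>Poly_Mapping.keys x. \<Sum>b\<in>Poly_Mapping.keys y.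
     Poly_Mapping.single (a, b) (Poly_Mapping.lookup x a * Poly_Mapping.lookup y b))"

definition tensor_map ::
    "(('a \<Rightarrow>\<^sub>0 'k::field) \<Rightarrow> ('c \<Rightarrow>\<^sub>0 'k)) \<Rightarrow> (('b \<Rightarrow>\<^sub>0 'k) \<Rightarrow> ('d \<Rightarrow>\<^sub>0 'k)) \<Rightarrow> ('a \<times> 'b \<Rightarrow>\<^sub>0 'k) \<Rightarrow> ('c \<times> 'd \<Rightarrow>\<^sub>0 'k)"
  where
  "tensor_map f g = lin_ext (\<lambda>(a, b). tensor (f (basis_vec a)) (g (basis_vec b)))"

definition subspace_tensor :: "('a \<Rightarrow>\<^sub>0 'k::field) set \<Rightarrow> ('b \<Rightarrow>\<^sub>0 'k) set \<Rightarrow> ('a \<times> 'b \<Rightarrow>\<^sub>0 'k) set" where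
  "subspace_tensor U V = module.span smul {tensor u v |u v. u \<in> U \<and> v \<in> V}"

text \<open>\<open>(f \<otimes> g)(z)\<close> for linear forms \<open>f\<close>, \<open>g\<close> on subspaces \<open>U\<close>, \<open>V\<close> and for \<open>z \<in> U \<otimes> V\<close>.\<close>

definition tensor_form ::
    "('a \<Rightarrow>\<^sub>0 'k::field) set \<Rightarrow> ('b \<Rightarrow>\<^sub>0 'k) set \<Rightarrow>
     (('a \<Rightarrow>\<^sub>0 'k) \<Rightarrow> 'k) \<Rightarrow> (('b \<Rightarrow>\<^sub>0 'k) \<Rightarrow> 'k) \<Rightarrow> ('a \<times> 'b \<Rightarrow>\<^sub>0 'k) \<Rightarrow> 'k" where
  "tensor_form U V f g z =
     (THE s. \<exists>ps. set ps \<subseteq> U \<times> V \<and> z = (\<Sum>(u, v)\<leftarrow>ps. tensor u v) \<and> s = (\<Sum>(u, v)\<leftarrow>ps. f u * g v))"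


section \<open>The algebra of an oriented graph\<close>

text \<open>
  With concatenation as addition of lists, \<open>'i list \<Rightarrow>\<^sub>0 'k\<close> is the free unitary associative
  algebra on \<open>'i\<close>. The free non-unitary algebra is its ideal of elements without constant term.
\<close>

instantiation list :: (type) monoid_add
begin

definition zero_list :: "'a list" where "zero_list = []"

definition plus_list :: "'a list \<Rightarrow> 'a list \<Rightarrow> 'a list" where "plus_list xs ys = xs @ ys"

instance
  by standard (simp_all add: zero_list_def plus_list_def)

end

definition free_nu :: "('i list \<Rightarrow>\<^sub>0 'k::field) set" where
  "free_nu = {x. Poly_Mapping.lookup x [] = 0}"

definition gen :: "'i \<Rightarrow> ('i list \<Rightarrow>\<^sub>0 'k::field)" where
  "gen i = basis_vec [i]"

definition nu_ideal :: "('i list \<Rightarrow>\<^sub>0 'k::field) set \<Rightarrow> bool" where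
  "nu_ideal J \<longleftrightarrow> J \<subseteq> free_nu \<and> 0 \<in> J \<and> (\<forall>x\<in>J. \<forall>y\<in>J. x + y \<in> J) \<and> (\<forall>c. \<forall>x\<in>J. smul c x \<in> J) \<and>
     (\<forall>x\<in>J. \<forall>y\<in>free_nu. x * y \<in> J \<and> y * x \<in> J)"

definition coset :: "('i list \<Rightarrow>\<^sub>0 'k::field) set \<Rightarrow> ('i list \<Rightarrow>\<^sub>0 'k) \<Rightarrow> ('i list \<Rightarrow>\<^sub>0 'k) set" where
  "coset J x = (\<lambda>j. x + j) ` J"

text \<open>
  The non-unitary algebra presented by the generators \<open>gen i\<close> and the relations \<open>r = 0\<close>, \<open>r \<in> R\<close>.
  Each operation on cosets is the union of the cosets obtained from all representatives, which
  are equal.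
\<close>

definition presented_alg ::
    "('i list \<Rightarrow>\<^sub>0 'k::field) set \<Rightarrow> ('k, ('i list \<Rightarrow>\<^sub>0 'k) set) nalg" where
  "presented_alg R = (let J = nu_ideal hull R in
     \<lparr> elems = coset J ` free_nu,
       zeroA = coset J 0,
       addA = (\<lambda>X Y. \<Union>x\<in>X. \<Union>y\<in>Y. coset J (x + y)),
       scaleA = (\<lambda>c X. \<Union>x\<in>X. coset J (smul c x)),
       multA = (\<lambda>X Y. \<Union>x\<in>X. \<Union>y\<in>Y. coset J (x * y)) \<rparr>)"

text \<open>
  An oriented graph on \<open>'i\<close> (loops allowed, no multiple edges) is a binary relation.
  The paths \<open>i \<rightarrow> i\<^sub>2 \<rightarrow> \<dots> \<rightarrow> i\<^sub>n\<close> from \<open>i\<close> with \<open>n\<close> vertices are given as lists.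
\<close>

definition paths :: "('i \<Rightarrow> 'i \<Rightarrow> bool) \<Rightarrow> 'i \<Rightarrow> nat \<Rightarrow> 'i list set" where
  "paths E i n = {p. p \<noteq> [] \<and> hd p = i \<and> length p = n \<and> successively E p}"

text \<open>\<open>P\<^bsub>i\<^sub>n\<^esub>(1) \<cdots> P\<^bsub>i\<^sub>1\<^esub>(1)\<close> for \<open>p = [i\<^sub>1, \<dots>, i\<^sub>n]\<close>.\<close>

definition path_prod :: "'i list \<Rightarrow> ('i list \<Rightarrow>\<^sub>0 'k::field)" where
  "path_prod p = prod_list (map gen (rev p))"

definition graph_relations :: "('i \<Rightarrow> 'i \<Rightarrow> bool) \<Rightarrow> ('i list \<Rightarrow>\<^sub>0 'k::field) set" where
  "graph_relations E =
     {gen j * gen i |i j. \<not> E i j} \<union>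
     {path_prod p - path_prod q |p q. \<exists>i n. p \<in> paths E i n \<and> q \<in> paths E i n}"

definition quadratic_relations :: "('i \<Rightarrow> 'i \<Rightarrow> bool) \<Rightarrow> ('i list \<Rightarrow>\<^sub>0 'k::field) set" where
  "quadratic_relations E =
     {gen j * gen i |i j. \<not> E i j} \<union>
     {gen j * gen i - gen k * gen i |i j k. E i j \<and> E i k}"

definition graph_alg :: "('i \<Rightarrow> 'i \<Rightarrow> bool) \<Rightarrow> ('k::field, ('i list \<Rightarrow>\<^sub>0 'k) set) nalg" where
  "graph_alg E = presented_alg (graph_relations E)"

definition P :: "('i \<Rightarrow> 'i \<Rightarrow> bool) \<Rightarrow> 'i \<Rightarrow> nat \<Rightarrow> ('i list \<Rightarrow>\<^sub>0 'k::field) set" where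
  "P E i n =
     (if paths E i n \<noteq> {} then coset (nu_ideal hull graph_relations E) (path_prod (SOME p. p \<in> paths E i n))
      else zeroA (graph_alg E))"


lemma coset_eq:
  assumes "nu_ideal J" "x - y \<in> J" shows "coset J x = coset J y"
proof -
  have "smul (- 1) z \<in> J" if "z \<in> J" for z using assms(1) that by (auto simp: nu_ideal_def)
  moreover have "smul (- 1) z = - z" for z :: "'a list \<Rightarrow>\<^sub>0 'b"
    by (rule poly_mapping_eqI) simp
  ultimately have m: "y - x \<in> J" using assms(2) by (metis minus_diff_eq)
  have 1: "u + v \<in> J" if "u \<in> J" "v \<in> J" for u v using assms(1) that by (auto simp: nu_ideal_def)
  show ?thesis unfolding coset_def
  proof (intro equalityI subsetI; elim imageE)
    fix z j assume "z = x + j" "j \<in> J"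
    then show "z \<in> (+) y ` J" using 1[OF assms(2), of j] by (auto intro!: image_eqI[of _ _ "x - y + j"])
  next
    fix z j assume "z = y + j" "j \<in> J"
    then show "z \<in> (+) x ` J" using 1[OF m, of j] by (auto intro!: image_eqI[of _ _ "y - x + j"])
  qed
qed


lemma nu_ideal_hull:
  assumes "R \<subseteq> free_nu" shows "nu_ideal (nu_ideal hull R :: ('i list \<Rightarrow>\<^sub>0 'k::field) set)"
proof -
  have mult0: "Poly_Mapping.lookup (x * y) [] = 0" if "x \<in> free_nu" for x y :: "'i list \<Rightarrow>\<^sub>0 'k"
  proof -
    have "[] \<notin> Poly_Mapping.keys (x * y)"
      using keys_mult[of x y] that by (auto simp: free_nu_def plus_list_def in_keys_iff)
    then show ?thesis by (simp add: in_keys_iff)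
  qed
  have "nu_ideal (free_nu :: ('i list \<Rightarrow>\<^sub>0 'k) set)"
    using mult0 by (auto simp: nu_ideal_def) (auto simp: free_nu_def lookup_add)
  then have "nu_ideal hull R \<subseteq> free_nu" using assms by (rule hull_minimal[rotated])
  then show ?thesis
    unfolding nu_ideal_def[of "_ hull _"] by (auto simp: hull_def) (auto simp: nu_ideal_def)
qed

lemma graph_relations_subset: "graph_relations E \<subseteq> free_nu"
proof -
  have 1: "path_prod p = basis_vec (rev p)" for p :: "'i list"
    by (induction p rule: rev_induct)
      (simp_all add: path_prod_def gen_def mult_single plus_list_def flip: single_one add: zero_list_def)
  show ?thesis
    by (auto simp: graph_relations_def free_nu_def 1 gen_def mult_single plus_list_def lookup_minus lookup_single when_def paths_def)
qed

lemma P_eq: "P E i n = coset (nu_ideal hull graph_relations E) (path_prod p)" if "p \<in> paths E i n"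
proof -
  have "(SOME q. q \<in> paths E i n) \<in> paths E i n" using that by (rule someI)
  then have "path_prod (SOME q. q \<in> paths E i n) - path_prod p \<in> nu_ideal hull graph_relations E"
    using that by (intro hull_inc) (auto simp: graph_relations_def)
  from coset_eq[OF nu_ideal_hull[OF graph_relations_subset] this] that show ?thesis
    by (auto simp: P_def)
qed


section \<open>Decorated rooted trees\<close>

text \<open>Isomorphism classes of non-planar rooted trees, i.e. plane trees up to reordering.\<close>

datatype 'i rtree = Node 'i "'i rtree multiset"

type_synonym 'i forest = "'i rtree multiset"

text \<open>The polynomial algebra on the rooted trees, and its tensor square.\<close>

type_synonym ('i, 'k) ck = "'i forest \<Rightarrow>\<^sub>0 'k"
type_synonym ('i, 'k) ck2 = "'i forest \<times> 'i forest \<Rightarrow>\<^sub>0 'k"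

primrec tree_deg :: "'i rtree \<Rightarrow> nat" where
  "tree_deg (Node i F) = Suc (sum_mset (image_mset tree_deg F))"

definition forest_deg :: "'i forest \<Rightarrow> nat" where
  "forest_deg F = sum_mset (image_mset tree_deg F)"

definition homogeneous :: "nat \<Rightarrow> ('i, 'k::field) ck set" where
  "homogeneous n = {x. \<forall>F\<in>Poly_Mapping.keys x. forest_deg F = n}"

subsection \<open>Cuts\<close>

text \<open>
  Sets of edges are described on a plane representative. Its vertices are addressed by lists of
  child indices; an edge is identified with its lower end, hence with a non-empty address.
\<close>

datatype 'i ptree = PNode 'i "'i ptree list"

primrec forget_order :: "'i ptree \<Rightarrow> 'i rtree" where
  "forget_order (PNode i ts) = Node i (mset (map forget_order ts))"

lemma surj_forget_order: "\<exists>s. forget_order s = t"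
proof (induction t)
  case (Node i F)
  then have "\<forall>t. \<exists>s. t \<in># F \<longrightarrow> forget_order s = t" by auto
  then obtain f where f: "\<And>t. t \<in># F \<Longrightarrow> forget_order (f t) = t" by metis
  obtain ts where ts: "mset ts = F" using ex_mset by blast
  then have "map (forget_order \<circ> f) ts = ts"
    by (intro map_idI) (auto intro: f)
  with ts have "forget_order (PNode i (map f ts)) = Node i F" by simp
  then show ?case by blast
qed

fun children :: "'i ptree \<Rightarrow> 'i ptree list" where
  "children (PNode i ts) = ts"

fun is_vertex :: "'i ptree \<Rightarrow> nat list \<Rightarrow> bool" where
  "is_vertex t [] \<longleftrightarrow> True"
| "is_vertex (PNode i ts) (k # p) \<longleftrightarrow> k < length ts \<and> is_vertex (ts ! k) p"

fun subtree_at :: "'i ptree \<Rightarrow> nat list \<Rightarrow> 'i ptree" where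
  "subtree_at t [] = t"
| "subtree_at (PNode i ts) (k # p) = subtree_at (ts ! k) p"

definition edges :: "'i ptree \<Rightarrow> nat list set" where
  "edges t = {e. e \<noteq> [] \<and> is_vertex t e}"

definition leaves :: "'i ptree \<Rightarrow> nat list set" where
  "leaves t = {l. is_vertex t l \<and> children (subtree_at t l) = []}"

text \<open>The edges on the path from the root to \<open>l\<close> are the non-empty prefixes of \<open>l\<close>.\<close>

definition admissible :: "'i ptree \<Rightarrow> nat list set \<Rightarrow> bool" where
  "admissible t c \<longleftrightarrow> c \<subseteq> edges t \<and> (\<forall>l\<in>leaves t. card {e\<in>c. prefix e l} \<le> 1)"

text \<open>The component of the root after deletion of the edges in \<open>c\<close>.\<close>

function root_component :: "nat list set \<Rightarrow> 'i ptree \<Rightarrow> 'i ptree" where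
  "root_component c (PNode i ts) =
     PNode i (map (\<lambda>k. root_component {p. k # p \<in> c} (ts ! k)) (filter (\<lambda>k. [k] \<notin> c) [0..<length ts]))"
  by pat_completeness auto
termination
  by (relation "measure (size \<circ> snd)") (auto simp: less_Suc_eq_le intro!: size_list_estimation')

text \<open>
  The components not containing the root are indexed by \<open>c\<close>: the one below \<open>e \<in> c\<close> is rooted at
  the lower end of \<open>e\<close>.
\<close>

definition cut_R :: "'i ptree \<Rightarrow> nat list set \<Rightarrow> 'i rtree" where
  "cut_R t c = forget_order (root_component c t)"

definition cut_P :: "'i ptree \<Rightarrow> nat list set \<Rightarrow> 'i forest" where
  "cut_P t c = image_mset (\<lambda>e. forget_order (root_component {p. e @ p \<in> c} (subtree_at t e))) (mset_set c)"

subsection \<open>The Hopf algebra structure\<close>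

definition coprod_ptree :: "'i ptree \<Rightarrow> ('i, 'k::field) ck2" where
  "coprod_ptree t =
     basis_vec ({#forget_order t#}, {#}) + basis_vec ({#}, {#forget_order t#}) +
     (\<Sum>c\<in>{c. admissible t c \<and> c \<noteq> {}}. basis_vec (cut_P t c, {#cut_R t c#}))"

text \<open>The result does not depend on the plane representative.\<close>

definition coprod_tree :: "'i rtree \<Rightarrow> ('i, 'k::field) ck2" where
  "coprod_tree t = coprod_ptree (SOME s. forget_order s = t)"

definition coprod :: "('i, 'k::field) ck \<Rightarrow> ('i, 'k) ck2" where
  "coprod = lin_ext (\<lambda>F. prod_mset (image_mset coprod_tree F))"

definition counit :: "('i, 'k::field) ck \<Rightarrow> 'k" where
  "counit x = Poly_Mapping.lookup x {#}"

text \<open>\<open>m \<circ> (f \<otimes> g) \<circ> \<Delta>\<close>\<close>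

definition convolution ::
    "(('i, 'k::field) ck \<Rightarrow> ('i, 'k) ck) \<Rightarrow> (('i, 'k) ck \<Rightarrow> ('i, 'k) ck) \<Rightarrow> ('i, 'k) ck \<Rightarrow> ('i, 'k) ck" where
  "convolution f g x = lin_ext (\<lambda>(F, G). f (basis_vec F) * g (basis_vec G)) (coprod x)"

definition is_antipode :: "(('i, 'k::field) ck \<Rightarrow> ('i, 'k) ck) \<Rightarrow> bool" where
  "is_antipode S \<longleftrightarrow> Vector_Spaces.linear smul smul S \<and>
     (\<forall>x. convolution S id x = smul (counit x) 1 \<and> convolution id S x = smul (counit x) 1)"

definition subalgebra :: "('i, 'k::field) ck set \<Rightarrow> bool" where
  "subalgebra B \<longleftrightarrow> module.subspace smul B \<and> 1 \<in> B \<and> (\<forall>x\<in>B. \<forall>y\<in>B. x * y \<in> B)"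

text \<open>The antipode is the unique \<open>S\<close> with \<^term>\<open>is_antipode S\<close>.\<close>

definition hopf_subalgebra :: "('i, 'k::field) ck set \<Rightarrow> bool" where
  "hopf_subalgebra B \<longleftrightarrow> subalgebra B \<and> coprod ` B \<subseteq> subspace_tensor B B \<and> (\<forall>S. is_antipode S \<longrightarrow> S ` B \<subseteq> B)"

definition graft :: "'i \<Rightarrow> ('i, 'k::field) ck \<Rightarrow> ('i, 'k) ck" where
  "graft i = lin_ext (\<lambda>F. basis_vec {#Node i F#})"

text \<open>The projection on the span of trees vanishing on forests that are not trees.\<close>

definition tree_proj :: "('i, 'k::field) ck \<Rightarrow> ('i, 'k) ck" where
  "tree_proj = lin_ext (\<lambda>F. if size F = 1 then basis_vec F else 0)"


section \<open>Systems of Dyson-Schwinger equations\<close>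

text \<open>
  The completion (the product of all homogeneous parts) is realized in the power series over
  \<open>('i, 'k) ck\<close>, the coefficient of index \<open>n\<close> being the component of degree \<open>n\<close>.
\<close>

definition completion :: "('i, 'k::field) ck fps set" where
  "completion = {x. \<forall>n. fps_nth x n \<in> homogeneous n}"

definition graft_hat :: "'i \<Rightarrow> ('i, 'k::field) ck fps \<Rightarrow> ('i, 'k) ck fps" where
  "graft_hat i x = Abs_fps (\<lambda>n. case n of 0 \<Rightarrow> 0 | Suc m \<Rightarrow> graft i (fps_nth x m))"

text \<open>Formal series in the indeterminates \<open>h\<^sub>j\<close>, \<open>j \<in> 'i\<close>; monomials are multisets of indices.\<close>

type_synonym ('i, 'k) mseries = "'i multiset \<Rightarrow> 'k"

definition monomial :: "'i multiset \<Rightarrow> ('i, 'k::field) mseries" where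
  "monomial \<alpha> = (\<lambda>\<beta>. if \<beta> = \<alpha> then 1 else 0)"

definition nonconstant :: "('i, 'k::field) mseries \<Rightarrow> bool" where
  "nonconstant f \<longleftrightarrow> (\<exists>\<alpha>. \<alpha> \<noteq> {#} \<and> f \<alpha> \<noteq> 0)"

text \<open>
  \<open>f(X\<^sub>j, j \<in> 'i)\<close> for series \<open>X\<^sub>j\<close> without constant term: in degree \<open>n\<close>, only the monomials of
  total degree at most \<open>n\<close> contribute.
\<close>

definition subst_series ::
    "('i::finite, 'k::field) mseries \<Rightarrow> ('i \<Rightarrow> ('i, 'k) ck fps) \<Rightarrow> ('i, 'k) ck fps" where
  "subst_series f X =
     Abs_fps (\<lambda>n. \<Sum>\<alpha>\<in>{\<alpha>. size \<alpha> \<le> n}. smul (f \<alpha>) (fps_nth (prod_mset (image_mset X \<alpha>)) n))"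

definition solves_sdse ::
    "('i::finite \<Rightarrow> ('i, 'k::field) mseries) \<Rightarrow> ('i \<Rightarrow> ('i, 'k) ck fps) \<Rightarrow> bool" where
  "solves_sdse F X \<longleftrightarrow> (\<forall>i. X i \<in> completion \<and> X i = graft_hat i (subst_series (F i) X))"

definition sdse_solution :: "('i::finite \<Rightarrow> ('i, 'k::field) mseries) \<Rightarrow> 'i \<Rightarrow> ('i, 'k) ck fps" where
  "sdse_solution F = (THE X. solves_sdse F X)"

lemma subst_series_cong:
  fixes X Y :: "'i::finite \<Rightarrow> ('i, 'k::field) ck fps"
  assumes "\<And>j m. m \<le> n \<Longrightarrow> fps_nth (X j) m = fps_nth (Y j) m"
  shows "fps_nth (subst_series f X) n = fps_nth (subst_series f Y) n"
proof -
  have "fps_nth (prod_mset (image_mset X \<alpha>)) m = fps_nth (prod_mset (image_mset Y \<alpha>)) m"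
    if "m \<le> n" for m \<alpha>
    using that
    by (induction \<alpha> arbitrary: m) (auto simp: fps_mult_nth assms intro!: sum.cong)
  then show ?thesis by (simp add: subst_series_def)
qed

lemma homogeneous_add: "x \<in> homogeneous n \<Longrightarrow> y \<in> homogeneous n \<Longrightarrow> x + y \<in> homogeneous n"
  using Poly_Mapping.keys_add[of x y] by (auto simp: homogeneous_def)

lemma homogeneous_sum: "(\<And>a. a \<in> A \<Longrightarrow> f a \<in> homogeneous n) \<Longrightarrow> sum f A \<in> homogeneous n"
proof (induction A rule: infinite_finite_induct)
  case (insert a A)
  then show ?case by (simp add: homogeneous_add)
qed (simp_all add: homogeneous_def)

lemma homogeneous_smul: "x \<in> homogeneous n \<Longrightarrow> smul c x \<in> homogeneous n"
  by (auto simp: homogeneous_def in_keys_iff)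

lemma homogeneous_mult:
  "x \<in> homogeneous m \<Longrightarrow> y \<in> homogeneous n \<Longrightarrow> x * y \<in> homogeneous (m + n)"
proof -
  assume xy: "x \<in> homogeneous m" "y \<in> homogeneous n"
  show ?thesis unfolding homogeneous_def
  proof (intro CollectI ballI)
    fix H assume "H \<in> Poly_Mapping.keys (x * y)"
    then obtain F G where "H = F + G" "F \<in> Poly_Mapping.keys x" "G \<in> Poly_Mapping.keys y"
      using keys_mult[of x y] by blast
    with xy show "forest_deg H = m + n" by (simp add: homogeneous_def forest_deg_def)
  qed
qed

lemma homogeneous_graft: "x \<in> homogeneous m \<Longrightarrow> graft i x \<in> homogeneous (Suc m)"
  unfolding graft_def lin_ext_def
  by (intro homogeneous_sum homogeneous_smul) (auto simp: homogeneous_def forest_deg_def)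

lemma completion_graft_hat_subst:
  fixes X :: "'i::finite \<Rightarrow> ('i, 'k::field) ck fps"
  assumes "\<And>j. X j \<in> completion"
  shows "graft_hat i (subst_series f X) \<in> completion"
proof -
  have "fps_nth (prod_mset (image_mset X \<alpha>)) m \<in> homogeneous m" for m \<alpha>
  proof (induction \<alpha> arbitrary: m)
    case empty
    then show ?case by (auto simp: homogeneous_def forest_deg_def one_poly_mapping.rep_eq in_keys_iff fps_one_nth lookup_one)
  next
    case (add j \<alpha>)
    have "fps_nth (X j) k * fps_nth (prod_mset (image_mset X \<alpha>)) (m - k) \<in> homogeneous m" if "k \<le> m" for k
      using homogeneous_mult[OF _ add, of "fps_nth (X j) k" k "m - k"] assms[of j] that
      by (auto simp: completion_def)
    then show ?case by (auto simp: fps_mult_nth intro!: homogeneous_sum)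
  qed
  then have "fps_nth (subst_series f X) m \<in> homogeneous m" for m
    by (auto simp: subst_series_def intro!: homogeneous_sum homogeneous_smul)
  then have "graft i (fps_nth (subst_series f X) m) \<in> homogeneous (Suc m)" for m
    by (rule homogeneous_graft)
  moreover have "0 \<in> homogeneous 0" by (simp add: homogeneous_def)
  ultimately show ?thesis
    by (simp add: completion_def graft_hat_def split: nat.split)
qed

lemma ex1_solves_sdse: "\<exists>!X. solves_sdse F X"
proof -
  define \<Phi> where "\<Phi> X i = graft_hat i (subst_series (F i) X)" for X :: "'a \<Rightarrow> ('a, 'b) ck fps" and i
  have step: "fps_nth (\<Phi> X i) n = fps_nth (\<Phi> Y i) n"
    if "\<And>j m. m < n \<Longrightarrow> fps_nth (X j) m = fps_nth (Y j) m" for X Y i n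
    using that subst_series_cong[of "n - 1" X Y "F i"]
    by (cases n) (auto simp: \<Phi>_def graft_hat_def)
  have agree: "fps_nth ((\<Phi> ^^ k) (\<lambda>_. 0) i) m = fps_nth ((\<Phi> ^^ Suc m) (\<lambda>_. 0) i) m" if "m < k" for m k i
    using that
  proof (induction m arbitrary: k i rule: less_induct)
    case (less m)
    then obtain k' where k: "k = Suc k'" "m \<le> k'" by (cases k) auto
    have "fps_nth ((\<Phi> ^^ k') (\<lambda>_. 0) j) l = fps_nth ((\<Phi> ^^ m) (\<lambda>_. 0) j) l" if "l < m" for j l
      using less.IH[of l k' j] less.IH[of l m j] that k by simp
    from step[where n=m and i=i, OF this] show ?case by (simp add: k)
  qed
  define Z where "Z i = Abs_fps (\<lambda>n. fps_nth ((\<Phi> ^^ Suc n) (\<lambda>_. 0) i) n)" for i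
  have "\<Phi> Z i = Z i" for i
  proof (rule fps_ext)
    fix n
    have "fps_nth (Z j) m = fps_nth ((\<Phi> ^^ n) (\<lambda>_. 0) j) m" if "m < n" for j m
      using agree[OF that, of j] by (simp add: Z_def)
    then have "fps_nth (\<Phi> Z i) n = fps_nth (\<Phi> ((\<Phi> ^^ n) (\<lambda>_. 0)) i) n"
      by (rule step)
    then show "fps_nth (\<Phi> Z i) n = fps_nth (Z i) n"
      by (simp add: Z_def[of i])
  qed
  moreover have "(\<Phi> ^^ n) (\<lambda>_. 0) i \<in> completion" for n i
    by (induction n arbitrary: i)
      (auto simp: \<Phi>_def completion_graft_hat_subst, auto simp: completion_def homogeneous_def)
  then have "fps_nth ((\<Phi> ^^ Suc n) (\<lambda>_. 0) i) n \<in> homogeneous n" for n i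
    unfolding completion_def by blast
  then have "Z i \<in> completion" for i unfolding Z_def completion_def by simp
  ultimately have "solves_sdse F Z" by (simp add: solves_sdse_def \<Phi>_def)
  moreover have "X = Y" if "solves_sdse F X" "solves_sdse F Y" for X Y
  proof -
    have "fps_nth (X i) n = fps_nth (Y i) n" for i n
    proof (induction n arbitrary: i rule: less_induct)
      case (less n)
      then show ?case using step[of n X Y i] that by (simp add: solves_sdse_def \<Phi>_def)
    qed
    then show ?thesis by (auto intro!: ext fps_ext)
  qed
  ultimately show ?thesis by blast
qed

lemma solves_sdse_solution: "solves_sdse F (sdse_solution F)"
  unfolding sdse_solution_def by (rule theI'[OF ex1_solves_sdse])

definition sdse_gens :: "('i::finite \<Rightarrow> ('i, 'k::field) mseries) \<Rightarrow> ('i, 'k) ck set" where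
  "sdse_gens F = {fps_nth (sdse_solution F i) n |i n. n \<ge> 1}"

definition sdse_alg :: "('i::finite \<Rightarrow> ('i, 'k::field) mseries) \<Rightarrow> ('i, 'k) ck set" where
  "sdse_alg F = subalgebra hull sdse_gens F"

definition hopf_sdse :: "('i::finite \<Rightarrow> ('i, 'k::field) mseries) \<Rightarrow> bool" where
  "hopf_sdse F \<longleftrightarrow> hopf_subalgebra (sdse_alg F)"

text \<open>
  The graded dual of the graded algebra \<open>B\<close>: the linear forms on \<open>B\<close> that vanish on almost all
  homogeneous parts of \<open>B\<close>. Linear forms on \<open>B\<close> are extended by \<open>0\<close> outside \<open>B\<close>.
\<close>

definition graded_dual :: "('i, 'k::field) ck set \<Rightarrow> (('i, 'k) ck \<Rightarrow> 'k) set" where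
  "graded_dual B = {f.
     (\<forall>x. x \<notin> B \<longrightarrow> f x = 0) \<and>
     (\<forall>x\<in>B. \<forall>y\<in>B. f (x + y) = f x + f y) \<and>
     (\<forall>c. \<forall>x\<in>B. f (smul c x) = c * f x) \<and>
     (\<exists>N. \<forall>n\<ge>N. \<forall>x\<in>B \<inter> homogeneous n. f x = 0)}"

text \<open>
  The coproduct of the dual is the transpose of the product and its unit is the counit, so
  \<open>\<Delta>(f) = f \<otimes> 1 + 1 \<otimes> f\<close> reads as follows.
\<close>

definition primitives :: "('i, 'k::field) ck set \<Rightarrow> (('i, 'k) ck \<Rightarrow> 'k) set" where
  "primitives B = {f \<in> graded_dual B. \<forall>x\<in>B. \<forall>y\<in>B. f (x * y) = f x * counit y + counit x * f y}"

definition sdse_star ::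
    "('i::finite \<Rightarrow> ('i, 'k::field) mseries) \<Rightarrow>
     (('i, 'k) ck \<Rightarrow> 'k) \<Rightarrow> (('i, 'k) ck \<Rightarrow> 'k) \<Rightarrow> (('i, 'k) ck \<Rightarrow> 'k)" where
  "sdse_star F f g =
     (THE h. h \<in> primitives (sdse_alg F) \<and>
        (\<forall>x\<in>module.span smul (sdse_gens F).
           h x = tensor_form (sdse_alg F) (sdse_alg F) f g (tensor_map tree_proj tree_proj (coprod x))))"

definition sdse_prelie ::
    "('i::finite \<Rightarrow> ('i, 'k::field) mseries) \<Rightarrow> ('k, ('i, 'k) ck \<Rightarrow> 'k) nalg" where
  "sdse_prelie F =
     \<lparr> elems = primitives (sdse_alg F),
       zeroA = (\<lambda>x. 0),
       addA = (\<lambda>f g x. f x + g x),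
       scaleA = (\<lambda>c f x. c * f x),
       multA = sdse_star F \<rparr>"

text \<open>The series \<open>F\<^sub>i = 1 + \<Sum>\<^bsub>i\<rightarrow>j\<^esub> h\<^sub>j\<close>.\<close>

definition graph_series :: "('i::finite \<Rightarrow> 'i \<Rightarrow> bool) \<Rightarrow> 'i \<Rightarrow> ('i, 'k::field) mseries" where
  "graph_series E i = (\<lambda>\<beta>. monomial {#} \<beta> + (\<Sum>j\<in>{j. E i j}. monomial {#j#} \<beta>))"

end

theory Submission
  imports Defs
begin

text \<open>
  Sending a word to the pair (last letter, length) if it spells a path of the graph, and to 0
  otherwise, defines a linear map from the free algebra onto the space with basis \<open>(i, n)\<close>. Under
  condition (c) the vertices reached from \<open>i\<close> in a given number of steps have the same direct
  descendants, so this map is multiplicative and its kernel is the ideal of relations.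

  The solution of the system is \<open>X\<^sub>i(n) = \<Sum>\<close> of the ladders along the paths with \<open>n\<close> vertices from
  \<open>i\<close>. Cutting a ladder cuts a path in two; under (c) the possible lower parts depend only on \<open>i\<close> and
  the length of the upper part, so \<open>\<Delta>(X\<^sub>i(n)) = X\<^sub>i(n) \<otimes> 1 + 1 \<otimes> X\<^sub>i(n) + \<Sum>\<^sub>k \<Sum>\<^sub>j X\<^sub>j(n - k) \<otimes> X\<^sub>i(k)\<close>, with \<open>j\<close>
  running over the ends of paths of length \<open>k\<close> from \<open>i\<close>. Dually, the functionals dual to the
  \<open>X\<^sub>i(n)\<close> multiply like the \<open>P\<^sub>i(n)\<close>. Conversely, if \<open>i \<rightarrow> j\<close> and \<open>i \<rightarrow> k\<close>, the
  coefficients of the ladders \<open>(i, j)\<close> and \<open>(i, k)\<close> agree on the whole algebra, and comparing them in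
  \<open>\<Delta>(X\<^sub>i(3))\<close> shows that \<open>j\<close> and \<open>k\<close> have the same direct descendants.
\<close>

section \<open>Linear algebra in free vector spaces\<close>

interpretation smul: vector_space "smul :: 'k::field \<Rightarrow> ('a \<Rightarrow>\<^sub>0 'k) \<Rightarrow> 'a \<Rightarrow>\<^sub>0 'k"
  by (rule vector_space_smul)

lemma smul_single [simp]: "smul c (Poly_Mapping.single a d) = Poly_Mapping.single a (c * d)"
  by (rule poly_mapping_eqI) (simp add: lookup_single when_def)

lemma smul_eq_mult: "smul c x = Poly_Mapping.single 0 c * (x :: 'a::monoid_add \<Rightarrow>\<^sub>0 'k::field)"
proof -
  have "Poly_Mapping.single 0 c * x = Poly_Mapping.map ((*) c) x"
    by (rule mult_map_scale_conv_mult[symmetric])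
  then show ?thesis by (simp add: smul_def)
qed

lemma in_span_basis_vec:
  fixes x :: "'a \<Rightarrow>\<^sub>0 'k::field"
  assumes "Poly_Mapping.keys x \<subseteq> S"
  shows "x \<in> smul.span (basis_vec ` S)"
proof -
  have "x = (\<Sum>a\<in>Poly_Mapping.keys x. smul (Poly_Mapping.lookup x a) (basis_vec a))"
    by (rule poly_mapping_eqI) (simp add: lookup_sum lookup_single when_def in_keys_iff if_distrib sum.If_cases sum.delta' cong: if_cong)
  also have "\<dots> \<in> smul.span (basis_vec ` S)"
    using assms by (intro smul.span_sum smul.span_scale smul.span_base) auto
  finally show ?thesis .
qed

text \<open>Reduces linear and bilinear identities to basis vectors. The set \<open>S\<close> serves
  statements that hold only on part of the space, such as non-empty words or pairs
  \<open>(i, n)\<close> with \<open>n \<ge> 1\<close>.\<close>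

lemma basis_induct_on [consumes 1, case_names zero basis add scale]:
  fixes x :: "'a \<Rightarrow>\<^sub>0 'k::field"
  assumes "Poly_Mapping.keys x \<subseteq> S"
    and "Q 0" and "\<And>a. a \<in> S \<Longrightarrow> Q (basis_vec a)"
    and "\<And>x y. Q x \<Longrightarrow> Q y \<Longrightarrow> Q (x + y)"
    and "\<And>c x. Q x \<Longrightarrow> Q (smul c x)"
  shows "Q x"
  using in_span_basis_vec[OF assms(1)]
proof (induction rule: smul.span_induct_alt)
  case base
  show ?case by (rule assms)
next
  case (step c x y)
  then obtain a where a: "x = basis_vec a" "a \<in> S" by blast
  have "Q (smul c (basis_vec a) + y)"
    using step a by (intro assms) auto
  then show ?case by (simp only: a)
qed

lemmas basis_induct = basis_induct_on[OF subset_UNIV, simplified, case_names zero basis add scale]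

lemma smul_mult_left [simp]: "smul c x * y = smul c (x * y)"
  for x y :: "'a::monoid_add \<Rightarrow>\<^sub>0 'k::field"
  by (simp add: smul_eq_mult mult.assoc)

lemma smul_mult_right [simp]: "x * smul c y = smul c (x * y)"
  for x y :: "'a::monoid_add \<Rightarrow>\<^sub>0 'k::field"
proof (induction x rule: basis_induct)
  case (basis a)
  show ?case
  proof (induction y arbitrary: c rule: basis_induct)
    case (basis b)
    then show ?case by (simp add: mult_single)
  qed (auto simp: smul.scale_right_distrib distrib_left mult.commute)
qed (auto simp: smul.scale_right_distrib distrib_right mult.commute)

text \<open>Summing over a common finite superset of the supports turns additivity into a termwise
  identity.\<close>

lemma lin_ext_superset:
  assumes "finite S" "Poly_Mapping.keys x \<subseteq> S"
  shows "lin_ext \<phi> x = (\<Sum>a\<in>S. smul (Poly_Mapping.lookup x a) (\<phi> a))"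
  unfolding lin_ext_def using assms
  by (intro sum.mono_neutral_left) (auto simp: in_keys_iff)

lemma lin_ext_zero [simp]: "lin_ext \<phi> 0 = 0"
  by (simp add: lin_ext_def)

lemma lin_ext_basis [simp]: "lin_ext \<phi> (Poly_Mapping.single a c) = smul c (\<phi> a)"
  by (subst lin_ext_superset[of "{a}"]) auto

lemma lin_ext_add [simp]: "lin_ext \<phi> (x + y) = lin_ext \<phi> x + lin_ext \<phi> y"
proof -
  let ?S = "Poly_Mapping.keys x \<union> Poly_Mapping.keys y"
  have "Poly_Mapping.keys (x + y) \<subseteq> ?S" by (rule Poly_Mapping.keys_add)
  then show ?thesis
    by (simp add: lin_ext_superset[of ?S] lookup_add smul.scale_left_distrib sum.distrib)
qed

lemma lin_ext_smul [simp]: "lin_ext \<phi> (smul c x) = smul c (lin_ext \<phi> x)"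
proof -
  have "Poly_Mapping.keys (smul c x) \<subseteq> Poly_Mapping.keys x" by (auto simp: in_keys_iff)
  then show ?thesis
    by (simp add: lin_ext_superset[of "Poly_Mapping.keys x"] smul.scale_sum_right)
qed

lemma lin_ext_diff [simp]: "lin_ext \<phi> (x - y) = lin_ext \<phi> x - lin_ext \<phi> y"
  using lin_ext_add[of \<phi> "x - y" y] by (simp del: lin_ext_add add: eq_diff_eq)

lemma lin_ext_sum [simp]: "lin_ext \<phi> (sum f S) = (\<Sum>s\<in>S. lin_ext \<phi> (f s))"
  by (induction S rule: infinite_finite_induct) auto

subsection \<open>Algebras given by a carrier\<close>

text \<open>Preservation of zero is a separate clause because a bare \<open>nalg\<close> record
  satisfies no axioms from which it could follow.\<close>

definition alg_hom :: "('k, 'a) nalg \<Rightarrow> ('k, 'b) nalg \<Rightarrow> ('a \<Rightarrow> 'b) \<Rightarrow> bool" where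
  "alg_hom A B \<phi> \<longleftrightarrow>
     \<phi> ` elems A \<subseteq> elems B \<and> \<phi> (zeroA A) = zeroA B \<and>
     (\<forall>x\<in>elems A. \<forall>y\<in>elems A. \<phi> (addA A x y) = addA B (\<phi> x) (\<phi> y)) \<and>
     (\<forall>c. \<forall>x\<in>elems A. \<phi> (scaleA A c x) = scaleA B c (\<phi> x)) \<and>
     (\<forall>x\<in>elems A. \<forall>y\<in>elems A. \<phi> (multA A x y) = multA B (\<phi> x) (\<phi> y))"

text \<open>Every axiom is an identity, a closure property or the existence of negatives, and these
  pass to a surjective image. This yields the axioms of the pre-Lie algebra from those of the free
  algebra.\<close>

lemma nu_algebra_image:
  assumes "nu_algebra A" "alg_hom A B \<phi>" "\<phi> ` elems A = elems B"
  shows "nu_algebra B"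
proof -
  have cl: "addA A x y \<in> elems A" "scaleA A c x \<in> elems A" "multA A x y \<in> elems A" "zeroA A \<in> elems A"
    if "x \<in> elems A" "y \<in> elems A" for x y c
    using assms(1) that by (simp_all add: nu_algebra_def)
  have zero: "zeroA A \<in> elems A" "zeroA B = \<phi> (zeroA A)"
    using assms(1,2) by (simp_all add: alg_hom_def nu_algebra_def)
  have hom: "addA B (\<phi> x) (\<phi> y) = \<phi> (addA A x y)" "scaleA B c (\<phi> x) = \<phi> (scaleA A c x)"
    "multA B (\<phi> x) (\<phi> y) = \<phi> (multA A x y)" if "x \<in> elems A" "y \<in> elems A" for x y c
    using assms(2) that by (simp_all add: alg_hom_def)
  have neg: "\<exists>y\<in>elems A. \<phi> (addA A x y) = \<phi> (zeroA A)" if "x \<in> elems A" for x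
    using assms(1) that unfolding nu_algebra_def by metis
  have comm: "addA A x y = addA A y x" if "x \<in> elems A" "y \<in> elems A" for x y
    using assms(1) that unfolding nu_algebra_def by blast
  have ax: "addA A (addA A x y) z = addA A x (addA A y z)" "addA A (zeroA A) x = x"
    "scaleA A 1 x = x" "scaleA A c (scaleA A d x) = scaleA A (c * d) x"
    "scaleA A (c + d) x = addA A (scaleA A c x) (scaleA A d x)"
    "scaleA A c (addA A x y) = addA A (scaleA A c x) (scaleA A c y)"
    "multA A (addA A x y) z = addA A (multA A x z) (multA A y z)"
    "multA A z (addA A x y) = addA A (multA A z x) (multA A z y)"
    "multA A (scaleA A c x) y = scaleA A c (multA A x y)"
    "multA A x (scaleA A c y) = scaleA A c (multA A x y)"
    if "x \<in> elems A" "y \<in> elems A" "z \<in> elems A" for x y z c d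
    using assms(1) that unfolding nu_algebra_def by meson+
  show ?thesis
    unfolding nu_algebra_def assms(3)[symmetric] zero ball_simps bex_simps
    using neg by (auto simp: hom cl zero ax intro!: arg_cong[where f = \<phi>] comm)
qed

lemma associative_alg_image:
  assumes "nu_algebra A" "associative_alg A" "alg_hom A B \<phi>" "\<phi> ` elems A = elems B"
  shows "associative_alg B"
proof -
  have cl: "multA A x y \<in> elems A" if "x \<in> elems A" "y \<in> elems A" for x y
    using assms(1) that by (simp add: nu_algebra_def)
  have hom: "multA B (\<phi> x) (\<phi> y) = \<phi> (multA A x y)" if "x \<in> elems A" "y \<in> elems A" for x y
    using assms(3) that by (simp add: alg_hom_def)
  show ?thesis
    unfolding associative_alg_def assms(4)[symmetric] ball_simps
    using assms(2) by (simp add: hom cl associative_alg_def)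
qed

text \<open>The map sending \<open>\<phi> x\<close> to \<open>\<psi> x\<close> is well defined and
  injective because the fibres coincide: the first isomorphism theorem for two quotients of
  \<open>C\<close>.\<close>

lemma isomorphic_alg_images:
  assumes "nu_algebra C" "alg_hom C A \<phi>" "\<phi> ` elems C = elems A"
    "alg_hom C B \<psi>" "\<psi> ` elems C = elems B"
    and ker: "\<And>x y. x \<in> elems C \<Longrightarrow> y \<in> elems C \<Longrightarrow> \<phi> x = \<phi> y \<longleftrightarrow> \<psi> x = \<psi> y"
  shows "isomorphic_alg A B"
proof -
  define \<theta> where "\<theta> = \<psi> \<circ> inv_into (elems C) \<phi>"
  have \<theta>: "\<theta> (\<phi> x) = \<psi> x" if "x \<in> elems C" for x
  proof -
    have "inv_into (elems C) \<phi> (\<phi> x) \<in> elems C" "\<phi> (inv_into (elems C) \<phi> (\<phi> x)) = \<phi> x"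
      using that by (auto intro: inv_into_into f_inv_into_f)
    with ker that show ?thesis by (auto simp: \<theta>_def)
  qed
  have hA: "addA A (\<phi> x) (\<phi> y) = \<phi> (addA C x y)" "scaleA A c (\<phi> x) = \<phi> (scaleA C c x)"
    "multA A (\<phi> x) (\<phi> y) = \<phi> (multA C x y)"
    and hB: "addA B (\<psi> x) (\<psi> y) = \<psi> (addA C x y)" "scaleA B c (\<psi> x) = \<psi> (scaleA C c x)"
    "multA B (\<psi> x) (\<psi> y) = \<psi> (multA C x y)"
    and cl: "addA C x y \<in> elems C" "scaleA C c x \<in> elems C" "multA C x y \<in> elems C"
    if "x \<in> elems C" "y \<in> elems C" for x y c
    using assms(1,2,4) that by (simp_all add: alg_hom_def nu_algebra_def)
  have "bij_betw \<theta> (\<phi> ` elems C) (\<psi> ` elems C)"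
    using ker by (auto simp: bij_betw_def inj_on_def \<theta> image_iff)
  moreover have "\<theta> (addA A x y) = addA B (\<theta> x) (\<theta> y)" "\<theta> (multA A x y) = multA B (\<theta> x) (\<theta> y)"
    "\<theta> (scaleA A c x) = scaleA B c (\<theta> x)"
    if "x \<in> \<phi> ` elems C" "y \<in> \<phi> ` elems C" for x y c
    using that by (auto simp: hA hB cl \<theta>)
  ultimately show ?thesis unfolding isomorphic_alg_def assms(3,5) by blast
qed


subsection \<open>Presented algebras\<close>

lemma basis_vec_Nil: "(basis_vec [] :: 'i list \<Rightarrow>\<^sub>0 'k::field) = 1"
  by (metis single_one zero_list_def)

lemma basis_vec_append: "(basis_vec (u @ v) :: 'i list \<Rightarrow>\<^sub>0 'k::field) = basis_vec u * basis_vec v"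
  by (simp add: mult_single plus_list_def)

lemma path_prod_eq: "path_prod p = basis_vec (rev p)"
  by (induction p rule: rev_induct)
    (simp_all add: path_prod_def gen_def basis_vec_Nil mult_single plus_list_def)

lemma free_nuI: "(\<And>w. w \<in> Poly_Mapping.keys x \<Longrightarrow> w \<noteq> []) \<Longrightarrow> x \<in> free_nu"
  by (auto simp: free_nu_def in_keys_iff)

lemma keys_free_nu: "x \<in> free_nu \<longleftrightarrow> Poly_Mapping.keys x \<subseteq> {w. w \<noteq> []}"
  by (auto simp: free_nu_def in_keys_iff)

lemma free_nu_closed [simp, intro]:
  "0 \<in> free_nu"
  "x \<in> free_nu \<Longrightarrow> y \<in> free_nu \<Longrightarrow> x + y \<in> free_nu"
  "x \<in> free_nu \<Longrightarrow> smul c x \<in> free_nu"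
  "w \<noteq> [] \<Longrightarrow> basis_vec w \<in> free_nu"
  by (auto simp: free_nu_def lookup_add lookup_single)

lemma free_nu_uminus [simp, intro]: "x \<in> free_nu \<Longrightarrow> - x \<in> free_nu"
  by (auto simp: free_nu_def)

lemma free_nu_diff [simp, intro]: "x \<in> free_nu \<Longrightarrow> y \<in> free_nu \<Longrightarrow> x - y \<in> free_nu"
  by (auto simp: free_nu_def lookup_minus)

lemma free_nu_mult_left [simp, intro]: "x \<in> free_nu \<Longrightarrow> x * y \<in> free_nu"
proof (rule free_nuI)
  fix w assume "x \<in> free_nu" "w \<in> Poly_Mapping.keys (x * y)"
  then show "w \<noteq> []" using keys_mult[of x y] by (auto simp: keys_free_nu plus_list_def)
qed

lemma nu_idealD:
  assumes "nu_ideal J"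
  shows nu_ideal_subset: "J \<subseteq> free_nu" and nu_ideal_zero: "0 \<in> J"
    and nu_ideal_add: "\<And>x y. x \<in> J \<Longrightarrow> y \<in> J \<Longrightarrow> x + y \<in> J"
    and nu_ideal_smul: "\<And>c x. x \<in> J \<Longrightarrow> smul c x \<in> J"
    and nu_ideal_mult_right: "\<And>x y. x \<in> J \<Longrightarrow> y \<in> free_nu \<Longrightarrow> x * y \<in> J"
    and nu_ideal_mult_left: "\<And>x y. x \<in> J \<Longrightarrow> y \<in> free_nu \<Longrightarrow> y * x \<in> J"
  using assms by (auto simp: nu_ideal_def)

lemma smul_minus_one: "smul (- 1) x = - x"
  by (rule poly_mapping_eqI) simp

lemma nu_ideal_uminus: "nu_ideal J \<Longrightarrow> x \<in> J \<Longrightarrow> - x \<in> J"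
  using nu_ideal_smul[of J x "-1"] by (simp add: smul_minus_one)

text \<open>An ideal here absorbs only factors from \<open>free_nu\<close>. The empty word is the
  unit, which lies outside, so it needs its own case.\<close>

lemma nu_ideal_mult_words:
  assumes "nu_ideal J" "x \<in> J"
  shows "basis_vec u * x * basis_vec v \<in> J"
proof -
  have "basis_vec u * x \<in> J"
    using assms nu_ideal_mult_left[OF assms, of "basis_vec u"] by (cases "u = []") (auto simp: basis_vec_Nil)
  then show ?thesis
    using nu_ideal_mult_right[OF assms(1), of _ "basis_vec v"] assms(1)
    by (cases "v = []") (auto simp: basis_vec_Nil)
qed

lemma coset_eq_iff:
  assumes "nu_ideal J" shows "coset J x = coset J y \<longleftrightarrow> x - y \<in> J"
proof
  assume "coset J x = coset J y"
  moreover have "x \<in> coset J x" using nu_ideal_zero[OF assms] by (force simp: coset_def)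
  ultimately show "x - y \<in> J" by (auto simp: coset_def)
qed (rule coset_eq[OF assms])

text \<open>The common source of the surjections onto \<open>graph_alg E\<close> and onto the
  pre-Lie algebra, which are compared through their kernels.\<close>

definition free_alg :: "('k::field, 'i list \<Rightarrow>\<^sub>0 'k) nalg" where
  "free_alg = \<lparr> elems = free_nu, zeroA = 0, addA = (+), scaleA = smul, multA = (*) \<rparr>"

lemma nu_algebra_free_alg: "nu_algebra free_alg"
proof -
  have "\<exists>y\<in>free_nu. x + y = 0" if "x \<in> free_nu" for x :: "'i list \<Rightarrow>\<^sub>0 'k::field"
    using that by (intro bexI[of _ "- x"]) auto
  then show ?thesis
    by (auto simp: nu_algebra_def free_alg_def add.assoc add.commute smul.scale_left_distrib
        smul.scale_right_distrib distrib_left distrib_right)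
qed

lemma associative_alg_free_alg: "associative_alg free_alg"
  by (simp add: associative_alg_def free_alg_def mult.assoc)

text \<open>All cosets in the defining unions coincide because \<open>J\<close> is an ideal, so the
  operations can be computed on representatives.\<close>

lemma presented_alg_simps:
  assumes "R \<subseteq> free_nu"
  defines "J \<equiv> nu_ideal hull R"
  shows elems_presented_alg: "elems (presented_alg R) = coset J ` free_nu"
    and zeroA_presented_alg: "zeroA (presented_alg R) = coset J 0"
    and addA_presented_alg: "addA (presented_alg R) (coset J x) (coset J y) = coset J (x + y)"
    and scaleA_presented_alg: "scaleA (presented_alg R) c (coset J x) = coset J (smul c x)"
    and multA_presented_alg: "x \<in> free_nu \<Longrightarrow> y \<in> free_nu \<Longrightarrow>
      multA (presented_alg R) (coset J x) (coset J y) = coset J (x * y)"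
proof -
  have J: "nu_ideal J" using nu_ideal_hull[OF assms(1)] by (simp add: J_def)
  have ne: "J \<noteq> {}" using nu_ideal_zero[OF J] by auto
  have "coset J ((x + a) + (y + b)) = coset J (x + y)" if "a \<in> J" "b \<in> J" for a b
    using nu_ideal_add[OF J that] by (simp add: coset_eq_iff[OF J])
  then show "addA (presented_alg R) (coset J x) (coset J y) = coset J (x + y)"
    using ne by (simp add: presented_alg_def Let_def flip: J_def) (simp add: coset_def[of J x] coset_def[of J y])
  have "coset J (smul c (x + a)) = coset J (smul c x)" if "a \<in> J" for a
    using nu_ideal_smul[OF J that] by (simp add: coset_eq_iff[OF J] smul.scale_right_distrib)
  then show "scaleA (presented_alg R) c (coset J x) = coset J (smul c x)"
    using ne by (simp add: presented_alg_def Let_def flip: J_def) (simp add: coset_def[of J x])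
  have "coset J ((x + a) * (y + b)) = coset J (x * y)"
    if xy: "x \<in> free_nu" "y \<in> free_nu" and ab: "a \<in> J" "b \<in> J" for a b
  proof -
    \<comment> \<open>Each summand has a factor in \<open>J\<close>, and the other factors
      \<open>x\<close> and \<open>y + b\<close> lie in \<open>free_nu\<close>, where
      \<open>J\<close> absorbs.\<close>
    have "(x + a) * (y + b) - x * y = x * b + a * (y + b)" by (simp add: distrib_left distrib_right)
    also have "\<dots> \<in> J"
      using ab xy nu_ideal_subset[OF J]
      by (intro nu_ideal_add[OF J] nu_ideal_mult_left[OF J] nu_ideal_mult_right[OF J]) auto
    finally show ?thesis by (simp add: coset_eq_iff[OF J])
  qed
  then show "multA (presented_alg R) (coset J x) (coset J y) = coset J (x * y)"
    if "x \<in> free_nu" "y \<in> free_nu"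
    using ne that by (simp add: presented_alg_def Let_def flip: J_def) (simp add: coset_def[of J x] coset_def[of J y])
qed (simp_all add: presented_alg_def Let_def J_def)

lemma alg_hom_coset:
  assumes "R \<subseteq> free_nu"
  shows "alg_hom free_alg (presented_alg R) (coset (nu_ideal hull R))"
  by (simp add: alg_hom_def presented_alg_simps[OF assms] free_alg_def)


subsection \<open>The graph algebra\<close>

lemma not_successively_split:
  "\<not> successively R p \<Longrightarrow> \<exists>u a b v. p = u @ [a, b] @ v \<and> \<not> R a b"
proof (induction p)
  case (Cons a p)
  show ?case
  proof (cases "successively R p")
    case True
    with Cons.prems obtain b q where "p = b # q" "\<not> R a b" by (cases p) auto
    then show ?thesis by (intro exI[of _ "[]"]) auto
  next
    case False
    with Cons.IH obtain u c b v where "p = u @ [c, b] @ v" "\<not> R c b" by blast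
    then show ?thesis by (intro exI[of _ "a # u"]) auto
  qed
qed simp

lemma path_prod_append: "path_prod (p @ q) = path_prod q * path_prod p"
  by (simp add: path_prod_def)

lemma path_prod_free_nu [simp]: "p \<noteq> [] \<Longrightarrow> path_prod p \<in> free_nu"
  by (simp add: path_prod_eq)

text \<open>A non-path contains consecutive vertices \<open>i\<close>, \<open>j\<close> without an
  edge, so its reversed word has the relation \<open>gen j * gen i\<close> as a factor.\<close>

lemma path_prod_not_path:
  assumes "nu_ideal J" "{gen j * gen i |i j. \<not> E i j} \<subseteq> J" "\<not> successively E p"
  shows "path_prod p \<in> J"
proof -
  obtain u i j v where p: "p = u @ [i, j] @ v" "\<not> E i j"
    using not_successively_split[OF assms(3)] by blast
  then have "gen j * gen i \<in> J" using assms(2) by blast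
  from nu_ideal_mult_words[OF assms(1) this, of "rev v" "rev u"] show ?thesis
    by (simp add: p path_prod_eq gen_def mult_single plus_list_def)
qed

lemma paths_not_Nil: "p \<in> paths E i n \<Longrightarrow> p \<noteq> []"
  by (simp add: paths_def)

lemma paths_0 [simp]: "paths E i 0 = {}"
  by (auto simp: paths_def)

lemma paths_1 [simp]: "paths E i (Suc 0) = {[i]}"
  by (auto simp: paths_def length_Suc_conv)

lemma finite_paths [simp]: "finite (paths E (i::'i::finite) n)"
  by (rule finite_subset[OF _ finite_lists_length_eq[of UNIV n]]) (auto simp: paths_def)

lemma paths_Suc_iff: "p \<in> paths E i (Suc (Suc n)) \<longleftrightarrow> (\<exists>j q. p = i # q \<and> E i j \<and> q \<in> paths E j (Suc n))"
  by (cases p; cases "tl p") (auto simp: paths_def)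

lemma append_in_paths:
  assumes "p \<noteq> []" "q \<noteq> []"
  shows "p @ q \<in> paths E i n \<longleftrightarrow>
    length p \<le> n \<and> p \<in> paths E i (length p) \<and> q \<in> paths E (hd q) (n - length p) \<and> E (last p) (hd q)"
  using assms by (auto simp: paths_def successively_append_iff)

text \<open>A fixed path for each basis index. It represents \<open>P E i n\<close>, and its ladder
  detects X_i(n).\<close>

definition some_path :: "('i \<Rightarrow> 'i \<Rightarrow> bool) \<Rightarrow> 'i \<times> nat \<Rightarrow> 'i list" where
  "some_path E v = (SOME p. p \<in> paths E (fst v) (snd v))"

lemma some_path: "p \<in> paths E i n \<Longrightarrow> some_path E (i, n) \<in> paths E i n"
  by (auto simp: some_path_def intro: someI)

abbreviation graph_ideal :: "('i \<Rightarrow> 'i \<Rightarrow> bool) \<Rightarrow> ('i list \<Rightarrow>\<^sub>0 'k::field) set" where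
  "graph_ideal E \<equiv> nu_ideal hull graph_relations E"

lemmas nu_ideal_graph_ideal = nu_ideal_hull[OF graph_relations_subset]

lemma zeroA_graph_alg: "zeroA (graph_alg E) = coset (graph_ideal E) 0"
  by (simp add: graph_alg_def zeroA_presented_alg[OF graph_relations_subset])

lemmas graph_alg_simps = presented_alg_simps[OF graph_relations_subset, folded graph_alg_def]

lemma path_prod_in_graph_ideal:
  assumes "\<not> successively E p" shows "path_prod p \<in> graph_ideal E"
proof (rule path_prod_not_path[OF nu_ideal_graph_ideal _ assms])
  show "{gen j * gen i |i j. \<not> E i j} \<subseteq> graph_ideal E"
    using hull_subset[of "graph_relations E"] by (auto simp: graph_relations_def)
qed

lemma path_diff_in_graph_relations:
  "p \<in> paths E i n \<Longrightarrow> q \<in> paths E i n \<Longrightarrow> path_prod p - path_prod q \<in> graph_relations E"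
  by (auto simp: graph_relations_def)

lemma two_path: "E i j \<Longrightarrow> [i, j] \<in> paths E i 2"
  by (simp add: paths_def)

text \<open>As \<open>P E i n\<close> defaults to zero when no path exists, the case
  \<open>n = 2\<close> yields a descendant. If \<open>i\<close> points to \<open>j\<close> and
  \<open>k\<close>, and \<open>l\<close> is a descendant of \<open>j\<close> but not of
  \<open>k\<close>, multiplying the relation between \<open>[i, j]\<close> and \<open>[i, k]\<close>
  by the generator of \<open>l\<close> forces \<open>P E i 3\<close> to vanish.\<close>

lemma P_nonzero_imp_condition:
  assumes "\<forall>i. \<forall>n\<ge>1. (P E i n :: ('i list \<Rightarrow>\<^sub>0 'k::field) set) \<noteq> zeroA (graph_alg E)"
  shows "(\<forall>i. \<exists>j. E i j) \<and> (\<forall>i j k. E i j \<and> E i k \<longrightarrow> (\<forall>l. E j l \<longleftrightarrow> E k l))"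
proof -
  have ne: "paths E i n \<noteq> {}" if "n \<ge> 1" for i n
    using assms[rule_format, OF that, of i] by (auto simp: P_def)
  have "\<exists>j. E i j" for i
    using ne[of "Suc (Suc 0)" i] by (auto simp: paths_Suc_iff)
  moreover have "E k l" if "E i j" "E i k" "E j l" for i j k l
  proof (rule ccontr)
    assume "\<not> E k l"
    let ?J = "graph_ideal E :: ('i list \<Rightarrow>\<^sub>0 'k) set"
    have J: "nu_ideal ?J" by (rule nu_ideal_graph_ideal)
    have "path_prod [i, j] - path_prod [i, k] \<in> ?J"
      using that(1,2) by (intro hull_inc path_diff_in_graph_relations[OF two_path two_path])
    then have "path_prod [l] * (path_prod [i, j] - path_prod [i, k]) \<in> ?J"
      by (intro nu_ideal_mult_left[OF J]) simp_all
    then have "path_prod [i, j, l] - path_prod [i, k, l] \<in> ?J"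
      by (simp add: right_diff_distrib flip: path_prod_append)
    moreover have "path_prod [i, k, l] \<in> ?J"
      using \<open>\<not> E k l\<close> by (intro path_prod_in_graph_ideal) simp
    ultimately have "path_prod [i, j, l] \<in> ?J"
      using nu_ideal_add[OF J, of "path_prod [i, j, l] - path_prod [i, k, l]" "path_prod [i, k, l]"] by simp
    moreover have "[i, j, l] \<in> paths E i 3"
      using that by (auto simp: paths_def)
    ultimately have "P E i 3 = zeroA (graph_alg E :: ('k, ('i list \<Rightarrow>\<^sub>0 'k) set) nalg)"
      by (simp add: P_eq zeroA_graph_alg coset_eq_iff[OF J])
    with assms show False by simp
  qed
  ultimately show ?thesis by blast
qed

text \<open>A vanishing member would give a one-term combination with coefficient 1 that is
  zero.\<close>

lemma graph_alg_basis_nonzero: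
  assumes "is_basis (graph_alg E) {(i, n). n \<ge> 1} (\<lambda>(i, n). P E i n :: ('i list \<Rightarrow>\<^sub>0 'k::field) set)"
  shows "\<forall>i. \<forall>n\<ge>1. P E i n \<noteq> zeroA (graph_alg E :: ('k, ('i list \<Rightarrow>\<^sub>0 'k) set) nalg)"
proof (intro allI impI notI)
  fix i n assume n: "1 \<le> n"
    and 0: "P E i n = zeroA (graph_alg E :: ('k, ('i list \<Rightarrow>\<^sub>0 'k) set) nalg)"
  have "lincomb (graph_alg E) (\<lambda>_. 1) (\<lambda>(i, n). P E i n) [(i, n)] =
      zeroA (graph_alg E :: ('k, ('i list \<Rightarrow>\<^sub>0 'k) set) nalg)"
    by (simp add: lincomb_def 0 graph_alg_simps)
  then show False
    using assms n unfolding is_basis_def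
    by (metis (mono_tags, lifting) case_prodI distinct_singleton empty_set empty_subsetI insert_subset
        list.set_intros(1) list.simps(15) mem_Collect_eq zero_neq_one)
qed

text \<open>Product of the algebra with basis \<open>(i, n)\<close>, the intended image of \<open>P\<^sub>i(n)\<close>.\<close>

definition basis_mult :: "('i \<Rightarrow> 'i \<Rightarrow> bool) \<Rightarrow> 'i \<times> nat \<Rightarrow> 'i \<times> nat \<Rightarrow> ('i \<times> nat \<Rightarrow>\<^sub>0 'k::field)" where
  "basis_mult E = (\<lambda>(j, n) (i, m). if (E ^^ m) i j then basis_vec (i, m + n) else 0)"

definition bilin_ext :: "('a \<Rightarrow> 'b \<Rightarrow> ('c \<Rightarrow>\<^sub>0 'k::field)) \<Rightarrow> ('a \<Rightarrow>\<^sub>0 'k) \<Rightarrow> ('b \<Rightarrow>\<^sub>0 'k) \<Rightarrow> ('c \<Rightarrow>\<^sub>0 'k)" where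
  "bilin_ext \<phi> x y = lin_ext (\<lambda>a. lin_ext (\<phi> a) y) x"

lemma bilin_ext_simps [simp]:
  "bilin_ext \<phi> 0 y = 0" "bilin_ext \<phi> x 0 = 0"
  "bilin_ext \<phi> (x + x') y = bilin_ext \<phi> x y + bilin_ext \<phi> x' y"
  "bilin_ext \<phi> x (y + y') = bilin_ext \<phi> x y + bilin_ext \<phi> x y'"
  "bilin_ext \<phi> (smul c x) y = smul c (bilin_ext \<phi> x y)"
  "bilin_ext \<phi> x (smul c y) = smul c (bilin_ext \<phi> x y)"
  "bilin_ext \<phi> (basis_vec a) (basis_vec b) = \<phi> a b"
proof -
  have add: "lin_ext (\<lambda>a. \<psi> a + \<chi> a) x = lin_ext \<psi> x + lin_ext \<chi> x" for x and \<psi> \<chi> :: "'x \<Rightarrow> 'y \<Rightarrow>\<^sub>0 'l::field"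
    by (simp add: lin_ext_def smul.scale_right_distrib sum.distrib)
  have scale: "lin_ext (\<lambda>a. smul c (\<psi> a)) x = smul c (lin_ext \<psi> x)" for c and x and \<psi> :: "'x \<Rightarrow> 'y \<Rightarrow>\<^sub>0 'l::field"
    by (simp add: lin_ext_def smul.scale_sum_right mult.commute)
  show "bilin_ext \<phi> x 0 = 0" by (simp add: bilin_ext_def lin_ext_def)
  show "bilin_ext \<phi> x (y + y') = bilin_ext \<phi> x y + bilin_ext \<phi> x y'"
    by (simp add: bilin_ext_def add)
  show "bilin_ext \<phi> x (smul c y) = smul c (bilin_ext \<phi> x y)"
    by (simp add: bilin_ext_def scale)
qed (simp_all add: bilin_ext_def)

text \<open>Words are products read from right to left, so \<open>rev w\<close> is the path and
  \<open>last w\<close> its starting vertex.\<close>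

definition word_class :: "('i \<Rightarrow> 'i \<Rightarrow> bool) \<Rightarrow> 'i list \<Rightarrow> ('i \<times> nat \<Rightarrow>\<^sub>0 'k::field)" where
  "word_class E w = (if w \<noteq> [] \<and> successively E (rev w) then basis_vec (last w, length w) else 0)"

abbreviation normal_form :: "('i \<Rightarrow> 'i \<Rightarrow> bool) \<Rightarrow> ('i list \<Rightarrow>\<^sub>0 'k::field) \<Rightarrow> ('i \<times> nat \<Rightarrow>\<^sub>0 'k)" where
  "normal_form E \<equiv> lin_ext (word_class E)"

definition model :: "('i \<times> nat \<Rightarrow>\<^sub>0 'k::field) set" where
  "model = {x. Poly_Mapping.keys x \<subseteq> {(i, n). n \<ge> 1}}"

lemma model_closed:
  "0 \<in> model" "x \<in> model \<Longrightarrow> y \<in> model \<Longrightarrow> x + y \<in> model" "x \<in> model \<Longrightarrow> smul c x \<in> model"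
  using Poly_Mapping.keys_add[of x y] by (auto simp: model_def in_keys_iff)

lemma normal_form_in_model: "normal_form E x \<in> model"
proof (induction x rule: basis_induct)
  case (basis w)
  show ?case by (cases w) (auto simp: model_def word_class_def)
qed (auto simp: model_closed)

lemma word_class_path: "p \<in> paths E i n \<Longrightarrow> word_class E (rev p) = basis_vec (i, n)"
  by (auto simp: word_class_def paths_def last_rev)

definition representative :: "('i \<Rightarrow> 'i \<Rightarrow> bool) \<Rightarrow> ('i \<times> nat \<Rightarrow>\<^sub>0 'k::field) \<Rightarrow> ('i list \<Rightarrow>\<^sub>0 'k)" where
  "representative E = lin_ext (\<lambda>v. path_prod (some_path E v))"

text \<open>Spanning half of the basis property. Modulo the relations, a path word equals the chosen
  path with the same start and length, and any other non-empty word is zero; linearity does the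
  rest.\<close>

lemma diff_representative_in_graph_ideal:
  assumes "x \<in> free_nu"
  shows "x - representative E (normal_form E x) \<in> graph_ideal E"
proof -
  note J = nu_ideal_graph_ideal[of E]
  from assms have "Poly_Mapping.keys x \<subseteq> {w. w \<noteq> []}" by (simp add: keys_free_nu)
  then show ?thesis
  proof (induction x rule: basis_induct_on)
    case zero
    then show ?case by (simp add: nu_ideal_zero[OF J] representative_def)
  next
    case (basis w)
    then have w: "w \<noteq> []" by simp
    show ?case
    proof (cases "successively E (rev w)")
      case True
      with w have p: "rev w \<in> paths E (last w) (length w)" by (simp add: paths_def hd_rev)
      from hull_inc[OF path_diff_in_graph_relations[OF p some_path[OF p]], of nu_ideal] show ?thesis
        using True w by (simp add: representative_def word_class_def path_prod_eq)
    next
      case False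
      from path_prod_in_graph_ideal[OF this] False w show ?thesis
        by (simp add: word_class_def representative_def path_prod_eq)
    qed
  next
    case (add x y)
    then show ?case using nu_ideal_add[OF J, of "x - _" "y - _"]
      by (simp add: representative_def algebra_simps)
  next
    case (scale c x)
    then show ?case using nu_ideal_smul[OF J, of "x - _" c]
      by (simp add: representative_def smul.scale_right_diff_distrib)
  qed
qed

section \<open>The graph algebra under condition (c)\<close>

locale uniform_graph =
  fixes E :: "'i::finite \<Rightarrow> 'i \<Rightarrow> bool"
  assumes descendant: "\<exists>j. E i j"
    and same_descendants: "E i j \<Longrightarrow> E i k \<Longrightarrow> E j l \<longleftrightarrow> E k l"
begin

lemma paths_nonempty: "paths E i (Suc n) \<noteq> {}"
proof (induction n arbitrary: i)
  case (Suc n)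
  obtain j where "E i j" using descendant by blast
  moreover obtain q where "q \<in> paths E j (Suc n)" using Suc by blast
  ultimately have "i # q \<in> paths E i (Suc (Suc n))" by (auto simp: paths_Suc_iff)
  then show ?case by blast
qed simp

lemma some_path_in: "n \<ge> 1 \<Longrightarrow> some_path E (i, n) \<in> paths E i n"
  using paths_nonempty[of i "n - 1"] some_path[of _ E i n] by (cases n) auto

text \<open>By induction the vertices before \<open>x\<close> and \<open>y\<close> have the same
  descendants, so \<open>x\<close> and \<open>y\<close> have a common ascendant and (c)
  applies.\<close>

lemma relpowp_same_descendants:
  "(E ^^ k) i x \<Longrightarrow> (E ^^ k) i y \<Longrightarrow> E x l \<longleftrightarrow> E y l"
proof (induction k arbitrary: x y l)
  case (Suc k)
  obtain x' y' where "(E ^^ k) i x'" "E x' x" "(E ^^ k) i y'" "E y' y"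
    using Suc.prems by (elim relpowp_Suc_E)
  moreover from this have "E x' y" using Suc.IH by blast
  ultimately show ?case using same_descendants by blast
qed simp

lemma relpowp_last_path: "p \<in> paths E i (Suc n) \<Longrightarrow> (E ^^ n) i (last p)"
proof (induction n arbitrary: p i)
  case (Suc n)
  obtain j q where p: "p = i # q" "E i j" "q \<in> paths E j (Suc n)"
    using Suc.prems by (auto simp: paths_Suc_iff)
  have "(E ^^ Suc n) i (last q)" using relpowp_Suc_I2[OF p(2) Suc.IH[OF p(3)]] .
  then show ?case using paths_not_Nil[OF p(3)] by (simp add: p(1))
qed simp

text \<open>All ends of paths with the same start and length have the same descendants, so the
  possible continuations do not depend on the path. This is the form in which equality of
  descendants is used below. A path with \<open>n\<close> vertices has \<open>n - 1\<close> edges,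
  hence its next vertex is \<open>n\<close> steps away from \<open>i\<close>.\<close>

lemma last_path_edge_iff:
  assumes "p \<in> paths E i n"
  shows "E (last p) j \<longleftrightarrow> (E ^^ n) i j"
proof (cases n)
  case 0
  with assms show ?thesis by simp
next
  case (Suc k)
  with assms have k: "(E ^^ k) i (last p)" by (auto intro: relpowp_last_path)
  show ?thesis
  proof
    show "(E ^^ n) i j" if "E (last p) j" using k that by (auto simp: Suc)
    assume "(E ^^ n) i j"
    then obtain y where y: "(E ^^ k) i y" "E y j" unfolding Suc by (elim relpowp_Suc_E)
    with relpowp_same_descendants[OF k y(1)] show "E (last p) j" by simp
  qed
qed

text \<open>In \<open>v @ w\<close> the path of \<open>w\<close> is travelled first. The edge from
  its end to \<open>last v\<close> exists exactly when \<open>last w\<close> reaches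
  \<open>last v\<close> in \<open>length w\<close> steps, which is the case distinction in
  \<open>basis_mult\<close>.\<close>

lemma word_class_append:
  assumes "v \<noteq> []" "w \<noteq> []"
  shows "word_class E (v @ w) = bilin_ext (basis_mult E) (word_class E v) (word_class E w)"
proof (cases "successively E (rev v) \<and> successively E (rev w)")
  case True
  with assms have "rev w \<in> paths E (last w) (length w)" by (simp add: paths_def hd_rev)
  from last_path_edge_iff[OF this, of "last v"] show ?thesis
    using True assms
    by (simp add: word_class_def successively_append_iff basis_mult_def hd_rev last_rev add.commute)
next
  case False
  then show ?thesis using assms by (auto simp: word_class_def successively_append_iff)
qed

lemma normal_form_mult:
  assumes "x \<in> free_nu" "y \<in> free_nu"
  shows "normal_form E (x * y) = bilin_ext (basis_mult E) (normal_form E x) (normal_form E y)"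
proof -
  from assms(1)[unfolded keys_free_nu] show ?thesis
  proof (induction x rule: basis_induct_on)
    case (basis v)
    from assms(2)[unfolded keys_free_nu] show ?case
    proof (induction y rule: basis_induct_on)
      case (basis w)
      with \<open>v \<in> _\<close> show ?case by (simp add: word_class_append flip: basis_vec_append)
    qed (simp_all add: distrib_left)
  qed (simp_all add: distrib_right)
qed

text \<open>By multiplicativity the kernel on \<open>free_nu\<close> is an ideal, and it contains
  the relations, hence also the ideal they generate.\<close>

lemma normal_form_graph_ideal:
  fixes x :: "'i list \<Rightarrow>\<^sub>0 'k::field"
  assumes "x \<in> graph_ideal E" shows "normal_form E x = 0"
proof -
  have "nu_ideal {x \<in> free_nu. normal_form E (x :: 'i list \<Rightarrow>\<^sub>0 'k) = 0}"
    by (auto simp: nu_ideal_def normal_form_mult)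
  moreover have "normal_form E x = 0" if "x \<in> graph_relations E" for x :: "'i list \<Rightarrow>\<^sub>0 'k"
    using that unfolding graph_relations_def
    by (auto simp: path_prod_eq word_class_path gen_def mult_single plus_list_def) (auto simp: word_class_def)
  then have "graph_relations E \<subseteq> {x \<in> free_nu. normal_form E (x :: 'i list \<Rightarrow>\<^sub>0 'k) = 0}"
    using graph_relations_subset[of E] by blast
  ultimately have "graph_ideal E \<subseteq> {x \<in> free_nu. normal_form E (x :: 'i list \<Rightarrow>\<^sub>0 'k) = 0}"
    by (rule hull_minimal[rotated])
  with assms show ?thesis by blast
qed

lemma graph_ideal_iff:
  assumes "x \<in> free_nu"
  shows "x \<in> graph_ideal E \<longleftrightarrow> normal_form E x = 0"
  using diff_representative_in_graph_ideal[OF assms, of E] normal_form_graph_ideal[of x]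
  by (auto simp: representative_def)

lemma normal_form_representative:
  assumes "m \<in> model" shows "normal_form E (representative E m) = m"
  using assms[unfolded model_def, THEN CollectD]
proof (induction m rule: basis_induct_on)
  case (basis v)
  then obtain i n where "v = (i, n)" "n \<ge> 1" by auto
  then show ?case
    using word_class_path[OF some_path_in[of n i]] by (simp add: representative_def path_prod_eq)
qed (simp_all add: representative_def)

lemma representative_free_nu:
  assumes "m \<in> model" shows "representative E m \<in> free_nu"
  using assms[unfolded model_def, THEN CollectD]
proof (induction m rule: basis_induct_on)
  case (basis v)
  then obtain i n where "v = (i, n)" "n \<ge> 1" by auto
  then show ?case
    using paths_not_Nil[OF some_path_in[of n i]] by (simp add: representative_def)
qed (simp_all add: representative_def)

lemma normal_form_surj: "normal_form E ` free_nu = model"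
  using normal_form_in_model[of E] normal_form_representative representative_free_nu
  by (metis (no_types, lifting) image_iff image_subsetI subsetI subset_antisym)

lemma P_some_path: "n \<ge> 1 \<Longrightarrow> P E i n = coset (graph_ideal E) (path_prod (some_path E (i, n)))"
  by (rule P_eq[OF some_path_in])

text \<open>Cosets are compared through normal forms: the congruence with
  \<open>representative\<close> gives spanning, and applying \<open>normal_form\<close> to a
  vanishing combination gives independence.\<close>

lemma graph_alg_basis:
  "is_basis (graph_alg E) {(i, n). n \<ge> 1} (\<lambda>(i, n). P E i n :: ('i list \<Rightarrow>\<^sub>0 'k::field) set)"
proof -
  let ?J = "graph_ideal E :: ('i list \<Rightarrow>\<^sub>0 'k) set"
  note J = nu_ideal_graph_ideal[of E]
  have lin: "lincomb (graph_alg E) c (\<lambda>(i, n). P E i n) js =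
      coset ?J (representative E (\<Sum>j\<leftarrow>js. smul (c j) (basis_vec j)))"
    if "set js \<subseteq> {(i, n). n \<ge> 1}" for c js
    using that by (induction js) (auto simp: lincomb_def graph_alg_simps representative_def P_some_path)
  have sum_model: "(\<Sum>j\<leftarrow>js. smul (c j) (basis_vec j)) \<in> (model :: ('i \<times> nat \<Rightarrow>\<^sub>0 'k) set)"
    if "set js \<subseteq> {(i, n). n \<ge> 1}" for c js
    using that by (induction js) (auto simp: model_closed simp del: smul_single intro!: model_closed, auto simp: model_def)
  show ?thesis unfolding is_basis_def
  proof (intro conjI ballI allI impI)
    fix j :: "'i \<times> nat" assume "j \<in> {(i, n). n \<ge> 1}"
    then show "(case j of (i, n) \<Rightarrow> P E i n) \<in> elems (graph_alg E :: ('k, ('i list \<Rightarrow>\<^sub>0 'k) set) nalg)"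
      using paths_not_Nil[OF some_path_in]
      by (cases j) (auto simp: P_some_path graph_alg_simps)
  next
    fix X assume "X \<in> elems (graph_alg E :: ('k, ('i list \<Rightarrow>\<^sub>0 'k) set) nalg)"
    then obtain x where x: "x \<in> free_nu" "X = coset ?J x" by (auto simp: graph_alg_simps)
    let ?m = "normal_form E x"
    obtain js where js: "set js = Poly_Mapping.keys ?m" "distinct js"
      using finite_distinct_list[of "Poly_Mapping.keys ?m"] by auto
    have sub: "set js \<subseteq> {(i, n). n \<ge> 1}"
      using normal_form_in_model[of E x] by (simp add: js model_def)
    have "?m = (\<Sum>j\<leftarrow>js. smul (Poly_Mapping.lookup ?m j) (basis_vec j))"
      by (rule poly_mapping_eqI)
        (simp add: sum_list_distinct_conv_sum_set js lookup_sum lookup_single when_def in_keys_iff sum.delta' cong: if_cong)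
    then have "X = lincomb (graph_alg E) (Poly_Mapping.lookup ?m) (\<lambda>(i, n). P E i n) js"
      using diff_representative_in_graph_ideal[OF x(1), of E]
      by (simp add: lin[OF sub] x(2) coset_eq_iff[OF J])
    with js sub show "\<exists>js c. distinct js \<and> set js \<subseteq> {(i, n). n \<ge> 1} \<and>
        X = lincomb (graph_alg E) c (\<lambda>(i, n). P E i n) js" by blast
  next
    fix js :: "('i \<times> nat) list" and c :: "'i \<times> nat \<Rightarrow> 'k" and j
    assume js: "distinct js \<and> set js \<subseteq> {(i, n). n \<ge> 1} \<and>
      lincomb (graph_alg E) c (\<lambda>(i, n). P E i n) js = zeroA (graph_alg E)" and j: "j \<in> set js"
    let ?m = "\<Sum>j\<leftarrow>js. smul (c j) (basis_vec j)"
    have "representative E ?m \<in> ?J"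
      using js lin[of js c]
      by (auto simp: graph_alg_simps coset_eq_iff[OF J] dest: nu_ideal_uminus[OF J])
    then have "?m = 0"
      using normal_form_graph_ideal normal_form_representative[OF sum_model] js by fastforce
    then have "Poly_Mapping.lookup ?m j = 0" by simp
    with js j show "c j = 0"
      by (simp add: sum_list_distinct_conv_sum_set lookup_sum lookup_single when_def sum.delta' cong: if_cong)
  qed
qed

text \<open>The quadratic relations are instances of the graph relations. Conversely, any two paths
  with the same start and length are congruent modulo the quadratic ones, by induction on the
  length: first the initial parts are exchanged, then the last vertex.\<close>

lemma graph_ideal_quadratic: "(graph_ideal E :: ('i list \<Rightarrow>\<^sub>0 'k::field) set) = nu_ideal hull quadratic_relations E"
proof
  have quad: "gen j * gen i - gen k * gen i \<in> (graph_relations E :: ('i list \<Rightarrow>\<^sub>0 'k) set)"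
    if "E i j" "E i k" for i j k
  proof -
    have "path_prod [i, j] - path_prod [i, k] \<in> (graph_relations E :: ('i list \<Rightarrow>\<^sub>0 'k) set)"
      using that by (rule path_diff_in_graph_relations[OF two_path two_path])
    then show ?thesis by (simp add: path_prod_def)
  qed
  then have sub: "quadratic_relations E \<subseteq> (graph_relations E :: ('i list \<Rightarrow>\<^sub>0 'k) set)"
    by (auto simp: quadratic_relations_def) (auto simp: graph_relations_def)
  then show "nu_ideal hull quadratic_relations E \<subseteq> (graph_ideal E :: ('i list \<Rightarrow>\<^sub>0 'k) set)"
    by (rule hull_mono)
  let ?Q = "nu_ideal hull quadratic_relations E :: ('i list \<Rightarrow>\<^sub>0 'k) set"
  have Q: "nu_ideal ?Q" using sub graph_relations_subset[of E] by (intro nu_ideal_hull) blast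
  have Qsub: "quadratic_relations E \<subseteq> ?Q" by (rule hull_subset)
  have "path_prod p - path_prod q \<in> ?Q" if "p \<in> paths E i n" "q \<in> paths E i n" for p q i n
    using that
  proof (induction n arbitrary: p q)
    case 0
    then show ?case by simp
  next
    case (Suc n)
    show ?case
    proof (cases n)
      case 0
      with Suc.prems show ?thesis using Q by (auto simp: nu_ideal_zero)
    next
      case (Suc k)
      obtain p' a where p: "p = p' @ [a]" using Suc.prems(1) paths_not_Nil by (metis rev_exhaust)
      obtain q' b where q: "q = q' @ [b]" using Suc.prems(2) paths_not_Nil by (metis rev_exhaust)
      have p': "p' \<in> paths E i n" "E (last p') a" and q': "q' \<in> paths E i n" "E (last q') b"
        using Suc.prems p q \<open>n = Suc k\<close>
        by (auto simp: paths_def successively_append_iff hd_append split: if_splits)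
      \<comment> \<open>\<open>p'\<close> and \<open>q'\<close> have the same start and length, so
        by (c) the last vertex \<open>a\<close> of \<open>p\<close> can also follow
        \<open>q'\<close>. The comparison of \<open>p\<close> with \<open>q\<close> goes through the
        path \<open>q' @ [a]\<close>.\<close>
      have "E (last q') a" using p' q'(1) by (simp add: last_path_edge_iff)
      obtain r c where r: "q' = r @ [c]" using q' paths_not_Nil by (metis rev_exhaust)
      have "E c a" "E c b" using \<open>E (last q') a\<close> q'(2) by (simp_all add: r)
      \<comment> \<open>The relation at the end \<open>c\<close> of \<open>q'\<close> exchanges the
        final vertices \<open>a\<close> and \<open>b\<close>.\<close>
      then have "gen a * gen c - gen b * gen c \<in> quadratic_relations E"
        unfolding quadratic_relations_def by blast
      with Qsub have "gen a * gen c - gen b * gen c \<in> ?Q" by blast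
      then have "(gen a * gen c - gen b * gen c) * basis_vec (rev r) \<in> ?Q"
        using nu_ideal_mult_words[OF Q, of _ "[]" "rev r"] by (simp add: basis_vec_Nil)
      then have 1: "gen a * path_prod q' - gen b * path_prod q' \<in> ?Q"
        by (simp add: r path_prod_append left_diff_distrib path_prod_eq[of r] mult.assoc) (simp add: path_prod_def)
      have "gen a * (path_prod p' - path_prod q') \<in> ?Q"
        using Suc.IH[OF p'(1) q'(1)] by (intro nu_ideal_mult_left[OF Q]) (auto simp: gen_def)
      from nu_ideal_add[OF Q this 1] show ?thesis
        by (simp add: p q path_prod_append right_diff_distrib) (simp add: path_prod_def)
    qed
  qed
  moreover have "{gen j * gen i |i j. \<not> E i j} \<subseteq> ?Q"
    using Qsub by (rule subset_trans[rotated]) (simp add: quadratic_relations_def)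
  ultimately have "graph_relations E \<subseteq> ?Q"
    unfolding graph_relations_def by blast
  with Q show "graph_ideal E \<subseteq> ?Q" by (intro hull_minimal)
qed

lemma graph_alg_quadratic: "graph_alg E = presented_alg (quadratic_relations E)"
  by (simp add: graph_alg_def presented_alg_def graph_ideal_quadratic)

lemma P_mult:
  assumes "m \<ge> 1" "n \<ge> 1"
  shows "multA (graph_alg E) (P E j n) (P E i m) =
    (if (E ^^ m) i j then P E i (m + n) else zeroA (graph_alg E))"
proof -
  let ?p = "some_path E (i, m)" and ?q = "some_path E (j, n)"
  note J = nu_ideal_graph_ideal[of E]
  have p: "?p \<in> paths E i m" and q: "?q \<in> paths E j n" using assms by (auto intro: some_path_in)
  have mult: "multA (graph_alg E) (P E j n) (P E i m) = coset (graph_ideal E) (path_prod (?p @ ?q))"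
    using paths_not_Nil[OF p] paths_not_Nil[OF q] assms
    by (simp add: P_some_path graph_alg_simps path_prod_append)
  have edge: "E (last ?p) (hd ?q) \<longleftrightarrow> (E ^^ m) i j"
    using last_path_edge_iff[OF p, of j] q by (simp add: paths_def)
  show ?thesis
  proof (cases "(E ^^ m) i j")
    case True
    with edge p q have "?p @ ?q \<in> paths E i (m + n)"
      by (auto simp: paths_def successively_append_iff)
    with True show ?thesis by (simp add: mult P_eq)
  next
    case False
    with edge p q have "\<not> successively E (?p @ ?q)"
      by (auto simp: paths_def successively_append_iff)
    from path_prod_in_graph_ideal[OF this] False show ?thesis
      by (simp add: mult graph_alg_simps coset_eq_iff[OF J])
  qed
qed

end

subsection \<open>Ladders\<close>

text \<open>The linear tree with decorations \<open>p\<close> read from the root, as a forest; empty for \<open>p = []\<close>.\<close>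

primrec ladder :: "'i list \<Rightarrow> 'i forest" where
  "ladder [] = {#}"
| "ladder (i # p) = {#Node i (ladder p)#}"

lemma ladder_inject [simp]: "ladder p = ladder q \<longleftrightarrow> p = q"
proof (induction p arbitrary: q)
  case Nil
  then show ?case by (cases q) auto
next
  case (Cons i p)
  then show ?case by (cases q) auto
qed

lemma forest_deg_ladder [simp]: "forest_deg (ladder p) = length p"
  by (induction p) (auto simp: forest_deg_def)

lemma size_ladder [simp]: "size (ladder p) = (if p = [] then 0 else 1)"
  by (cases p) auto

primrec plane_ladder :: "'i list \<Rightarrow> 'i \<Rightarrow> 'i ptree" where
  "plane_ladder [] i = PNode i []"
| "plane_ladder (j # p) i = PNode i [plane_ladder p j]"

lemma forget_order_plane_ladder [simp]: "forget_order (plane_ladder p i) = Node i (ladder p)"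
  by (induction p arbitrary: i) auto

text \<open>No vertex of a ladder has two children to reorder, so the plane representative is
  unique. This determines the choice made in \<open>coprod_tree\<close>.\<close>

lemma forget_order_eq_ladder: "forget_order s = Node i (ladder p) \<Longrightarrow> s = plane_ladder p i"
proof (induction p arbitrary: s i)
  case Nil
  then show ?case by (cases s) auto
next
  case (Cons j p)
  obtain ts where s: "s = PNode i ts" using Cons.prems by (cases s) auto
  with Cons.prems have "mset (map forget_order ts) = {#Node j (ladder p)#}" by simp
  then obtain t where "ts = [t]" "forget_order t = Node j (ladder p)"
    by (cases ts) auto
  with Cons.IH s show ?case by simp
qed

lemma is_vertex_plane_ladder:
  "is_vertex (plane_ladder p i) e \<longleftrightarrow> (\<exists>k\<le>length p. e = replicate k 0)"
proof (induction p arbitrary: i e)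
  case Nil
  then show ?case by (cases e) auto
next
  case (Cons j p)
  show ?case
  proof (cases e)
    case (Cons k e')
    have "(\<exists>m\<le>Suc (length p). k # e' = replicate m 0) \<longleftrightarrow> k = 0 \<and> (\<exists>m\<le>length p. e' = replicate m 0)"
    proof safe
      fix m assume "m \<le> Suc (length p)" "k # e' = replicate m 0"
      then show "k = 0" "\<exists>m\<le>length p. e' = replicate m 0" by (cases m; auto)+
    next
      fix m assume "m \<le> length p"
      then show "\<exists>n\<le>Suc (length p). 0 # replicate m 0 = replicate n 0"
        by (intro exI[of _ "Suc m"]) simp
    qed
    with Cons show ?thesis by (auto simp: Cons.IH)
  qed auto
qed

lemma subtree_at_plane_ladder:
  "k \<le> length p \<Longrightarrow> subtree_at (plane_ladder p i) (replicate k 0) = plane_ladder (drop k p) ((i # p) ! k)"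
proof (induction k arbitrary: p i)
  case (Suc k)
  then show ?case by (cases p) auto
qed simp

lemma children_plane_ladder [simp]: "children (plane_ladder p i) = [] \<longleftrightarrow> p = []"
  by (cases p) auto

lemma edges_plane_ladder: "edges (plane_ladder p i) = (\<lambda>k. replicate (Suc k) 0) ` {..<length p}"
proof (intro equalityI subsetI)
  fix e assume "e \<in> edges (plane_ladder p i)"
  then obtain k where "k \<le> length p" "e = replicate k 0" "e \<noteq> []"
    by (auto simp: edges_def is_vertex_plane_ladder)
  then show "e \<in> (\<lambda>k. replicate (Suc k) 0) ` {..<length p}" by (cases k) auto
next
  fix e assume "e \<in> (\<lambda>k. replicate (Suc k) (0::nat)) ` {..<length p}"
  then obtain k where "e = replicate (Suc k) 0" "Suc k \<le> length p" by auto
  then show "e \<in> edges (plane_ladder p i)"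
    by (auto simp: edges_def is_vertex_plane_ladder simp del: replicate.simps)
qed

lemma leaves_plane_ladder: "leaves (plane_ladder p i) = {replicate (length p) 0}"
  by (auto simp: leaves_def is_vertex_plane_ladder subtree_at_plane_ladder)

text \<open>Every edge lies on the path from the root to the only leaf, so an admissible cut has at
  most one edge. The edge with lower end at depth \<open>Suc k\<close> has address
  \<open>replicate (Suc k) 0\<close>.\<close>

lemma admissible_plane_ladder:
  "{c. admissible (plane_ladder p i) c \<and> c \<noteq> {}} = (\<lambda>k. {replicate (Suc k) 0}) ` {..<length p}"
proof -
  have pre: "{e \<in> c. prefix e (replicate (length p) 0)} = c" if "c \<subseteq> edges (plane_ladder p i)" for c
  proof -
    have "prefix (replicate (Suc k) 0) (replicate (length p) (0::nat))" if "k < length p" for k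
      using that by (auto simp: prefix_def replicate_add[symmetric] simp del: replicate.simps
        intro!: exI[of _ "replicate (length p - Suc k) 0"])
    with that show ?thesis by (auto simp: edges_plane_ladder)
  qed
  show ?thesis
  proof (intro equalityI subsetI)
    fix c assume "c \<in> {c. admissible (plane_ladder p i) c \<and> c \<noteq> {}}"
    then have c: "c \<subseteq> edges (plane_ladder p i)" "c \<noteq> {}" "card c \<le> 1"
      by (auto simp: admissible_def leaves_plane_ladder pre)
    have "finite c" using c(1) by (rule finite_subset) (simp add: edges_plane_ladder)
    with c have "card c = 1" by (simp add: le_Suc_eq)
    then obtain e where "c = {e}" by (rule card_1_singletonE)
    with c(1) show "c \<in> (\<lambda>k. {replicate (Suc k) 0}) ` {..<length p}"
      by (auto simp: edges_plane_ladder)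
  next
    fix c assume "c \<in> (\<lambda>k. {replicate (Suc k) (0::nat)}) ` {..<length p}"
    then obtain k where k: "c = {replicate (Suc k) 0}" "k < length p" by blast
    then have "c \<subseteq> edges (plane_ladder p i)" by (auto simp: edges_plane_ladder)
    with pre[OF this] k(1) show "c \<in> {c. admissible (plane_ladder p i) c \<and> c \<noteq> {}}"
      by (simp add: admissible_def leaves_plane_ladder)
  qed
qed

text \<open>The address \<open>[]\<close> belongs to the root and not to an edge. Such a set arises
  in \<open>cut_P\<close> below the only edge of a cut, where the edge itself is shifted to
  \<open>[]\<close>.\<close>

lemma root_component_trivial: "c \<subseteq> {[]} \<Longrightarrow> root_component c t = t"
proof (induction t arbitrary: c)
  case (PNode i ts)
  then have "\<And>k. {p. k # p \<in> c} = {}" "\<And>k. [k] \<notin> c" by auto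
  with PNode show ?case by (simp add: map_nth cong: map_cong) (rule nth_equalityI, auto)
qed

lemma root_component_plane_ladder:
  "k < length p \<Longrightarrow> root_component {replicate (Suc k) 0} (plane_ladder p i) = plane_ladder (take k p) i"
proof (induction k arbitrary: p i)
  case 0
  then show ?case by (cases p) auto
next
  case (Suc k)
  then show ?case by (cases p) auto
qed

lemma cut_P_plane_ladder:
  assumes "k < length p"
  shows "cut_P (plane_ladder p i) {replicate (Suc k) 0} = ladder (drop k p)"
proof -
  have "{q. replicate (Suc k) 0 @ q \<in> {replicate (Suc k) (0::nat)}} \<subseteq> {[]}" by auto
  with assms show ?thesis
    by (simp add: cut_P_def root_component_trivial subtree_at_plane_ladder del: replicate.simps flip: Cons_nth_drop_Suc)
qed

lemma cut_R_plane_ladder: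
  "k < length p \<Longrightarrow> {#cut_R (plane_ladder p i) {replicate (Suc k) 0}#} = ladder (i # take k p)"
  by (simp add: cut_R_def root_component_plane_ladder del: replicate.simps)

text \<open>The index \<open>k\<close> counts the vertices staying with the root:
  \<open>k = 0\<close> is the term t \<otimes> 1, the largest \<open>k\<close> is 1 \<otimes> t, and
  the values between are the cuts of a single edge.\<close>

lemma coprod_tree_ladder:
  "coprod_tree (Node i (ladder p)) =
    (\<Sum>k\<le>Suc (length p). basis_vec (ladder (drop k (i # p)), ladder (take k (i # p))) :: ('i, 'k::field) ck2)"
proof -
  let ?b = "\<lambda>k. basis_vec (ladder (drop k (i # p)), ladder (take k (i # p))) :: ('i, 'k) ck2"
  have "(SOME s. forget_order s = Node i (ladder p)) = plane_ladder p i"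
    by (rule some_equality) (auto intro: forget_order_eq_ladder)
  then have "coprod_tree (Node i (ladder p)) = (coprod_ptree (plane_ladder p i) :: ('i, 'k) ck2)"
    by (simp add: coprod_tree_def)
  also have "\<dots> = ?b 0 + ?b (Suc (length p)) + (\<Sum>k<length p. ?b (Suc k))"
  proof -
    have inj: "inj_on (\<lambda>k. {replicate (Suc k) (0::nat)}) {..<length p}"
      by (auto simp: inj_on_def dest!: arg_cong[of _ _ length])
    have "(\<Sum>c\<in>{c. admissible (plane_ladder p i) c \<and> c \<noteq> {}}.
        basis_vec (cut_P (plane_ladder p i) c, {#cut_R (plane_ladder p i) c#})) = (\<Sum>k<length p. ?b (Suc k))"
      unfolding admissible_plane_ladder sum.reindex[OF inj]
      by (intro sum.cong refl)
        (simp only: cut_P_plane_ladder cut_R_plane_ladder lessThan_iff take_Suc_Cons drop_Suc_Cons comp_apply)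
    then show ?thesis by (simp add: coprod_ptree_def)
  qed
  also have "\<dots> = (\<Sum>k\<le>Suc (length p). ?b k)"
    by (simp only: sum.atMost_Suc_shift sum.lessThan_Suc[symmetric] lessThan_Suc_atMost add.assoc add.commute)
      (simp add: lessThan_Suc_atMost[symmetric] add.commute)
  finally show ?thesis .
qed

subsection \<open>The coproduct\<close>

lemma coprod_linear [simp]:
  "coprod 0 = 0" "coprod (x + y) = coprod x + coprod y" "coprod (smul c x) = smul c (coprod x)"
  "coprod (sum f S) = (\<Sum>s\<in>S. coprod (f s))"
  by (simp_all add: coprod_def)

lemma coprod_one [simp]: "coprod 1 = 1"
  by (simp add: coprod_def flip: single_one)

lemma coprod_mult [simp]: "coprod (x * y) = coprod x * coprod y"
proof (induction x rule: basis_induct)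
  case (basis F)
  show ?case
  proof (induction y rule: basis_induct)
    case (basis G)
    then show ?case by (simp add: coprod_def mult_single)
  qed (simp_all add: distrib_left)
qed (simp_all add: distrib_right)

lemma coprod_ladder:
  "coprod (basis_vec (ladder p)) = (\<Sum>k\<le>length p. basis_vec (ladder (drop k p), ladder (take k p)))"
proof (cases p)
  case Nil
  have "basis_vec {#} = (1 :: ('a, 'b) ck)" "basis_vec ({#}, {#}) = (1 :: ('a, 'b) ck2)"
    by (simp_all add: zero_prod_def flip: single_one)
  with Nil show ?thesis by simp
next
  case (Cons i q)
  then show ?thesis by (simp add: coprod_def coprod_tree_ladder del: sum.atMost_Suc)
qed

lemma tensor_eq_bilin_ext: "tensor = bilin_ext (\<lambda>a b. basis_vec (a, b))"
  by (intro ext) (simp add: tensor_def bilin_ext_def lin_ext_def smul.scale_sum_right del: smul.scale_scale)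

lemma tensor_simps [simp]:
  "tensor 0 y = 0" "tensor x 0 = 0"
  "tensor (x + x') y = tensor x y + tensor x' y" "tensor x (y + y') = tensor x y + tensor x y'"
  "tensor (smul c x) y = smul c (tensor x y)" "tensor x (smul c y) = smul c (tensor x y)"
  "tensor (basis_vec a) (basis_vec b) = basis_vec (a, b)"
  by (simp_all add: tensor_eq_bilin_ext)

lemma tensor_sum_left: "tensor (sum f S) y = (\<Sum>s\<in>S. tensor (f s) y)"
  by (induction S rule: infinite_finite_induct) auto

lemma tensor_sum_right: "tensor x (sum f S) = (\<Sum>s\<in>S. tensor x (f s))"
  by (induction S rule: infinite_finite_induct) auto

lemma tensor_mult:
  fixes u u' :: "'a::monoid_add \<Rightarrow>\<^sub>0 'k::field" and v v' :: "'b::monoid_add \<Rightarrow>\<^sub>0 'k"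
  shows "tensor u v * tensor u' v' = tensor (u * u') (v * v')"
proof (induction u rule: basis_induct)
  case (basis a)
  show ?case
  proof (induction v rule: basis_induct)
    case (basis b)
    show ?case
    proof (induction u' rule: basis_induct)
      case (basis a')
      show ?case
      proof (induction v' rule: basis_induct)
        case (basis b')
        show ?case by (simp add: mult_single)
      qed (simp_all add: distrib_left)
    qed (simp_all add: distrib_left)
  qed (simp_all add: distrib_right)
qed (simp_all add: distrib_right)

lemma tensor_one: "tensor 1 1 = 1"
  by (simp add: zero_prod_def flip: single_one)

lemma lookup_tensor: "Poly_Mapping.lookup (tensor u v) (a, b) = Poly_Mapping.lookup u a * Poly_Mapping.lookup v b"
proof (induction u rule: basis_induct)
  case (basis a')
  show ?case
  proof (induction v rule: basis_induct)
    case (basis b')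
    show ?case by (simp add: lookup_single when_def)
  qed (simp_all add: lookup_add algebra_simps)
qed (simp_all add: lookup_add algebra_simps)

subsection \<open>The solution of the system\<close>

text \<open>Shown in \<open>sdse_solution_nth\<close> to be the component X_i(n) of the
  solution.\<close>

definition path_sum :: "('i \<Rightarrow> 'i \<Rightarrow> bool) \<Rightarrow> 'i \<Rightarrow> nat \<Rightarrow> ('i, 'k::field) ck" where
  "path_sum E i n = (\<Sum>p\<in>paths E i n. basis_vec (ladder p))"

lemma path_sum_0 [simp]: "path_sum E i 0 = 0"
  by (simp add: path_sum_def)

lemma path_sum_1 [simp]: "path_sum E i (Suc 0) = basis_vec {#Node i {#}#}"
  by (simp add: path_sum_def)

lemma paths_Suc_Suc: "paths E i (Suc (Suc n)) = (\<Union>j\<in>{j. E i j}. (#) i ` paths E j (Suc n))"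
  by (auto simp: paths_Suc_iff image_iff) blast

lemma paths_disjoint: "j \<noteq> k \<Longrightarrow> paths E j m \<inter> paths E k n = {}"
  by (auto simp: paths_def)

lemma path_sum_Suc:
  fixes E :: "'i::finite \<Rightarrow> 'i \<Rightarrow> bool"
  shows "path_sum E i (Suc (Suc n)) = (\<Sum>j\<in>{j. E i j}. graft i (path_sum E j (Suc n)))"
proof -
  have "path_sum E i (Suc (Suc n)) = (\<Sum>j\<in>{j. E i j}. \<Sum>p\<in>(#) i ` paths E j (Suc n). basis_vec (ladder p))"
    unfolding path_sum_def paths_Suc_Suc
    by (rule sum.UNION_disjoint) (auto dest: paths_disjoint)
  also have "\<dots> = (\<Sum>j\<in>{j. E i j}. graft i (path_sum E j (Suc n)))"
    by (simp add: sum.reindex path_sum_def graft_def)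
  finally show ?thesis .
qed

lemma finite_multisets: "finite {\<alpha> :: 'i::finite multiset. size \<alpha> \<le> n}"
proof (rule finite_subset)
  show "{\<alpha> :: 'i multiset. size \<alpha> \<le> n} \<subseteq> mset ` {xs. set xs \<subseteq> UNIV \<and> length xs \<le> n}"
  proof
    fix \<alpha> :: "'i multiset" assume "\<alpha> \<in> {\<alpha>. size \<alpha> \<le> n}"
    moreover obtain xs where "mset xs = \<alpha>" using ex_mset by blast
    ultimately show "\<alpha> \<in> mset ` {xs. set xs \<subseteq> UNIV \<and> length xs \<le> n}" by auto
  qed
  show "finite (mset ` {xs :: 'i list. set xs \<subseteq> UNIV \<and> length xs \<le> n})"
    by (intro finite_imageI finite_lists_length_le) simp
qed

lemma graph_series_empty [simp]: "graph_series E i {#} = 1"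
  by (simp add: graph_series_def monomial_def)

lemma graph_series_singleton [simp]: "graph_series E i {#j#} = (if E i j then 1 else 0)"
  for E :: "'i::finite \<Rightarrow> 'i \<Rightarrow> bool"
  by (simp add: graph_series_def monomial_def sum.delta)

lemma graph_series_large: "size \<alpha> \<noteq> 0 \<Longrightarrow> size \<alpha> \<noteq> 1 \<Longrightarrow> graph_series E i \<alpha> = 0"
  by (auto simp: graph_series_def monomial_def intro!: sum.neutral)

lemma nonconstant_graph_series: "nonconstant (graph_series E i :: ('i::finite, 'k::field) mseries) \<longleftrightarrow> (\<exists>j. E i j)"
proof
  assume "nonconstant (graph_series E i :: ('i, 'k) mseries)"
  then obtain \<alpha> where \<alpha>: "\<alpha> \<noteq> {#}" "(graph_series E i :: ('i, 'k) mseries) \<alpha> \<noteq> 0"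
    by (auto simp: nonconstant_def)
  then have "size \<alpha> = 1" using graph_series_large[of \<alpha> E i] by (cases "size \<alpha>") auto
  then obtain j where "\<alpha> = {#j#}" using size_1_singleton_mset by blast
  with \<alpha>(2) show "\<exists>j. E i j" by (auto split: if_splits)
next
  assume "\<exists>j. E i j"
  then obtain j where "E i j" ..
  then show "nonconstant (graph_series E i :: ('i, 'k) mseries)"
    by (auto simp: nonconstant_def intro!: exI[of _ "{#j#}"])
qed

text \<open>The series has degree at most 1, so only the empty and the one-element multisets
  contribute. In degree 0 the truncation leaves only the empty one, which agrees because the
  \<open>X j\<close> have no constant term.\<close>

lemma subst_graph_series:
  fixes E :: "'i::finite \<Rightarrow> 'i \<Rightarrow> bool"
    and X :: "'i \<Rightarrow> ('i, 'k::field) ck fps"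
  assumes "\<And>j. fps_nth (X j) 0 = 0"
  shows "fps_nth (subst_series (graph_series E i) X) n = fps_nth 1 n + (\<Sum>j\<in>{j. E i j}. fps_nth (X j) n)"
proof -
  let ?t = "\<lambda>\<alpha>. smul (graph_series E i \<alpha>) (fps_nth (prod_mset (image_mset X \<alpha>)) n)"
  show ?thesis
  proof (cases n)
    case 0
    then have "{\<alpha>. size \<alpha> \<le> n} = {{#} :: 'i multiset}" by auto
    with 0 show ?thesis by (simp add: subst_series_def assms)
  next
    case (Suc m)
    have "(\<Sum>\<alpha>\<in>{\<alpha>. size \<alpha> \<le> n}. ?t \<alpha>) = (\<Sum>\<alpha>\<in>insert {#} ((\<lambda>j. {#j#}) ` UNIV). ?t \<alpha>)"
    proof (rule sum.mono_neutral_right[OF finite_multisets])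
      show "insert {#} ((\<lambda>j. {#j#}) ` UNIV) \<subseteq> {\<alpha> :: 'i multiset. size \<alpha> \<le> n}" using Suc by auto
      show "\<forall>\<alpha>\<in>{\<alpha>. size \<alpha> \<le> n} - insert {#} ((\<lambda>j. {#j#}) ` UNIV). ?t \<alpha> = 0"
      proof
        fix \<alpha> :: "'i multiset" assume "\<alpha> \<in> {\<alpha>. size \<alpha> \<le> n} - insert {#} ((\<lambda>j. {#j#}) ` UNIV)"
        then have "size \<alpha> \<noteq> 0" "size \<alpha> \<noteq> 1" using size_1_singleton_mset[of \<alpha>] by auto
        then have "graph_series E i \<alpha> = (0 :: 'k)" by (rule graph_series_large)
        then show "?t \<alpha> = 0" by simp
      qed
    qed
    also have "\<dots> = fps_nth 1 n + (\<Sum>j\<in>UNIV. ?t {#j#})"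
      by (subst sum.insert) (auto simp: sum.reindex inj_on_def)
    also have "(\<Sum>j\<in>UNIV. ?t {#j#}) = (\<Sum>j\<in>{j. E i j}. fps_nth (X j) n)"
      by (intro sum.mono_neutral_cong_right) auto
    finally show ?thesis by (simp add: subst_series_def)
  qed
qed

lemma graft_linear: "graft i 0 = 0" "graft i (x + y) = graft i x + graft i y"
  "graft i (sum f S) = (\<Sum>s\<in>S. graft i (f s))"
  by (simp_all add: graft_def)

text \<open>The equation expresses degree \<open>Suc m\<close> through degree \<open>m\<close>, and
  splitting off the first vertex of a path gives the path sums the same recursion.\<close>

lemma sdse_solution_nth:
  fixes E :: "'i::finite \<Rightarrow> 'i \<Rightarrow> bool"
  shows "fps_nth (sdse_solution (graph_series E) i) n = (path_sum E i n :: ('i, 'k::field) ck)"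
proof -
  define X where "X = (sdse_solution (graph_series E) :: 'i \<Rightarrow> ('i, 'k) ck fps)"
  have X: "X i = graft_hat i (subst_series (graph_series E i) X)" for i
    using solves_sdse_solution[of "graph_series E :: 'i \<Rightarrow> ('i, 'k) mseries"] by (simp add: solves_sdse_def X_def)
  have X0: "fps_nth (X j) 0 = 0" for j by (subst X) (simp add: graft_hat_def)
  have nth_Suc: "fps_nth (X i) (Suc m) = graft i (fps_nth 1 m) + (\<Sum>j\<in>{j. E i j}. graft i (fps_nth (X j) m))" for i m
    by (subst X) (simp add: graft_hat_def subst_graph_series[OF X0] graft_linear)
  have "fps_nth (X i) n = path_sum E i n"
  proof (induction n arbitrary: i)
    case (Suc m)
    have "fps_nth (X i) (Suc m) = graft i (fps_nth 1 m) + (\<Sum>j\<in>{j. E i j}. graft i (path_sum E j m))"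
      by (subst nth_Suc) (simp add: Suc.IH)
    then show ?case
      \<comment> \<open>For \<open>m = 0\<close> only the constant term of the series contributes,
        giving the single vertex; for larger \<open>m\<close> it contributes nothing and
        \<open>path_sum_Suc\<close> applies.\<close>
      by (cases m) (simp_all add: graft_linear path_sum_Suc, simp add: graft_def flip: single_one)
  qed (simp add: X0)
  then show ?thesis by (simp add: X_def)
qed


subsection \<open>The Hopf condition\<close>

lemma smul_subspace_kernel:
  assumes "\<And>x y. f (x + y) = f x + (f y :: 'k)" "\<And>c x. f (smul c x) = c * f x"
  shows "smul.subspace {x :: 'a \<Rightarrow>\<^sub>0 'k::field. f x = 0}"
proof -
  have "f 0 = 0" using assms(2)[of 0 0] by simp
  then show ?thesis by (auto simp: smul.subspace_def assms)
qed

text \<open>A non-empty ladder is a single tree, so a product of forests equals it only if one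
  factor is empty. Taking its coefficient is thus an infinitesimal character, as required of
  primitive elements of the dual.\<close>

lemma lookup_mult_ladder:
  fixes x y :: "('i, 'k::field) ck"
  assumes "p \<noteq> []"
  shows "Poly_Mapping.lookup (x * y) (ladder p) =
    Poly_Mapping.lookup x (ladder p) * counit y + counit x * Poly_Mapping.lookup y (ladder p)"
proof (induction x rule: basis_induct)
  case (basis F)
  show ?case
  proof (induction y rule: basis_induct)
    case (basis G)
    have "F + G = ladder p \<longleftrightarrow> F = ladder p \<and> G = {#} \<or> F = {#} \<and> G = ladder p"
      using assms by (cases p) (auto simp: union_is_single)
    moreover have "ladder p \<noteq> {#}" using assms by (cases p) auto
    ultimately show ?case
      by (auto simp: mult_single lookup_single counit_def when_def)
  qed (simp_all add: counit_def lookup_add distrib_left algebra_simps)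
qed (simp_all add: counit_def lookup_add distrib_right algebra_simps)

lemma subalgebra_sdse_alg: "subalgebra (sdse_alg F)"
proof -
  have "subalgebra (\<Inter>T)" if "\<forall>B\<in>T. subalgebra B" for T :: "('a, 'b) ck set set"
    using that by (auto simp: subalgebra_def smul.subspace_def)
  then show ?thesis unfolding sdse_alg_def by (rule hull_in) blast
qed

lemmas subspace_sdse_alg = subalgebra_sdse_alg[unfolded subalgebra_def, THEN conjunct1]
lemmas one_in_sdse_alg = subalgebra_sdse_alg[unfolded subalgebra_def, THEN conjunct2, THEN conjunct1]

lemma mult_in_sdse_alg: "x \<in> sdse_alg F \<Longrightarrow> y \<in> sdse_alg F \<Longrightarrow> x * y \<in> sdse_alg F"
  using subalgebra_sdse_alg[of F] by (simp add: subalgebra_def)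

lemma counit_one [simp]: "counit 1 = 1"
  by (simp add: counit_def lookup_one)

lemma lookup_path_sum:
  fixes E :: "'i::finite \<Rightarrow> 'i \<Rightarrow> bool"
  shows "Poly_Mapping.lookup (path_sum E i n) (ladder p) = (if p \<in> paths E i n then 1 else 0)"
  by (simp add: path_sum_def lookup_sum lookup_single when_def sum.delta)

lemma counit_path_sum [simp]: "counit (path_sum E i n) = 0"
  for E :: "'i::finite \<Rightarrow> 'i \<Rightarrow> bool"
  using paths_not_Nil[of "[]" E i n]
  by (auto simp: counit_def lookup_path_sum[of E i n "[]", simplified])

lemma sdse_gens_graph_series:
  fixes E :: "'i::finite \<Rightarrow> 'i \<Rightarrow> bool"
  shows "sdse_gens (graph_series E) = {path_sum E i n |i n. n \<ge> 1}"
  by (simp add: sdse_gens_def sdse_solution_nth)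

abbreviation graph_sdse_alg :: "('i::finite \<Rightarrow> 'i \<Rightarrow> bool) \<Rightarrow> ('i, 'k::field) ck set" where
  "graph_sdse_alg E \<equiv> sdse_alg (graph_series E)"

lemma path_sum_in_sdse_alg: "path_sum E i n \<in> graph_sdse_alg E"
proof (cases n)
  case 0
  then show ?thesis by (simp add: smul.subspace_0[OF subspace_sdse_alg])
next
  case (Suc m)
  then show ?thesis
    unfolding sdse_alg_def sdse_gens_graph_series by (intro hull_inc) auto
qed

lemma coprod_path_sum:
  fixes E :: "'i::finite \<Rightarrow> 'i \<Rightarrow> bool"
  shows "coprod (path_sum E i n) =
    (\<Sum>p\<in>paths E i n. \<Sum>k\<le>n. basis_vec (ladder (drop k p), ladder (take k p)))"
  unfolding path_sum_def coprod_linear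
  by (intro sum.cong refl) (simp add: coprod_ladder, simp add: paths_def)

text \<open>Only the position \<open>k = length p\<close> can cut a path into \<open>p\<close> and
  \<open>q\<close>; the hypothesis places it in the range of summation.\<close>

lemma lookup_coprod_path_sum:
  fixes E :: "'i::finite \<Rightarrow> 'i \<Rightarrow> bool"
  assumes "length p \<le> n"
  shows "Poly_Mapping.lookup (coprod (path_sum E i n)) (ladder q, ladder p) =
    (if p @ q \<in> paths E i n then 1 else (0 :: 'k::field))"
proof -
  have "(\<Sum>k\<le>n. if drop k r = q \<and> take k r = p then 1 else (0 :: 'k)) = (if r = p @ q then 1 else 0)"
    if "length r = n" for r
  proof -
    have "drop k r = q \<and> take k r = p \<longleftrightarrow> k = length p \<and> r = p @ q" if "k \<le> n" for k
      using that \<open>length r = n\<close> by (metis append_eq_conv_conj append_take_drop_id length_take min.absorb2)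
    then have "(\<Sum>k\<le>n. if drop k r = q \<and> take k r = p then 1 else (0 :: 'k)) =
        (\<Sum>k\<le>n. if k = length p then (if r = p @ q then 1 else 0) else 0)"
      by (intro sum.cong) auto
    then show ?thesis using assms by (simp add: sum.delta)
  qed
  moreover have "length r = n" if "r \<in> paths E i n" for r using that by (simp add: paths_def)
  ultimately show ?thesis
    by (simp add: coprod_path_sum lookup_sum lookup_single when_def sum.delta)
qed

lemma hopf_imp_same_descendants:
  fixes E :: "'i::finite \<Rightarrow> 'i \<Rightarrow> bool"
  assumes "hopf_sdse (graph_series E :: 'i \<Rightarrow> ('i, 'k::field) mseries)"
    and "E i j" "E i k" "E j l"
  shows "E k l"
proof -
  let ?B = "graph_sdse_alg E :: ('i, 'k) ck set"
  \<comment> \<open>\<open>\<phi>\<close> is a difference of infinitesimal characters and vanishes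
    on all generators, since \<open>[i, j]\<close> and \<open>[i, k]\<close> are both paths; so it
    vanishes on the algebra. \<open>\<Omega>\<close> is the coefficient of the ladder of
    \<open>[l]\<close> tensored with \<open>\<phi>\<close>, so it vanishes on the tensor square of
    the algebra.\<close>
  define \<phi> :: "('i, 'k) ck \<Rightarrow> 'k" where
    "\<phi> x = Poly_Mapping.lookup x (ladder [i, j]) - Poly_Mapping.lookup x (ladder [i, k])" for x
  define \<Omega> :: "('i, 'k) ck2 \<Rightarrow> 'k" where
    "\<Omega> z = Poly_Mapping.lookup z (ladder [l], ladder [i, j]) - Poly_Mapping.lookup z (ladder [l], ladder [i, k])" for z
  have "subalgebra {x. \<phi> x = 0}"
    unfolding subalgebra_def
  proof (intro conjI ballI)
    show "smul.subspace {x. \<phi> x = 0}"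
      by (rule smul_subspace_kernel) (simp_all add: \<phi>_def lookup_add algebra_simps)
    show "x * y \<in> {x. \<phi> x = 0}" if "x \<in> {x. \<phi> x = 0}" "y \<in> {x. \<phi> x = 0}" for x y
      using that lookup_mult_ladder[of "[i, j]" x y] lookup_mult_ladder[of "[i, k]" x y]
      by (simp add: \<phi>_def del: ladder.simps)
  qed (simp add: \<phi>_def lookup_one)
  moreover have "sdse_gens (graph_series E) \<subseteq> {x. \<phi> x = 0}"
  proof -
    have "[i, j] \<in> paths E a n \<longleftrightarrow> [i, k] \<in> paths E a n" for a n
      using assms(2,3) by (auto simp: paths_def)
    then show ?thesis
      by (auto simp: sdse_gens_graph_series \<phi>_def lookup_path_sum simp del: ladder.simps)
  qed
  ultimately have B: "?B \<subseteq> {x. \<phi> x = 0}"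
    unfolding sdse_alg_def by (rule hull_minimal[rotated])
  have "subspace_tensor ?B ?B \<subseteq> {z. \<Omega> z = 0}"
    unfolding subspace_tensor_def
  proof (rule smul.span_minimal)
    show "smul.subspace {z. \<Omega> z = 0}"
      by (rule smul_subspace_kernel) (simp_all add: \<Omega>_def lookup_add algebra_simps)
    have "\<Omega> (tensor u v) = Poly_Mapping.lookup u (ladder [l]) * \<phi> v" for u v
      by (simp add: \<Omega>_def \<phi>_def lookup_tensor algebra_simps del: ladder.simps)
    then show "{tensor u v |u v. u \<in> ?B \<and> v \<in> ?B} \<subseteq> {z. \<Omega> z = 0}"
      using B by auto
  qed
  moreover have "coprod (path_sum E i 3) \<in> subspace_tensor ?B ?B"
    using assms(1) path_sum_in_sdse_alg[of E i 3] by (auto simp: hopf_sdse_def hopf_subalgebra_def)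
  ultimately have "\<Omega> (coprod (path_sum E i 3)) = 0" by blast
  \<comment> \<open>The two coefficients in \<open>\<Omega>\<close> record whether
    \<open>[i, j, l]\<close> and \<open>[i, k, l]\<close> are paths.\<close>
  then have "[i, j] @ [l] \<in> paths E i 3 \<longleftrightarrow> [i, k] @ [l] \<in> paths E i 3"
    by (simp add: \<Omega>_def lookup_coprod_path_sum del: ladder.simps append.simps split: if_splits)
  with assms(2-) show ?thesis by (simp add: paths_def)
qed

section \<open>Closure of the generated algebra under coproduct and antipode\<close>

lemma span_mult_closed:
  fixes A B C :: "('a::monoid_add \<Rightarrow>\<^sub>0 'k::field) set"
  assumes "\<And>a b. a \<in> A \<Longrightarrow> b \<in> B \<Longrightarrow> a * b \<in> smul.span C"
    and "x \<in> smul.span A" "y \<in> smul.span B"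
  shows "x * y \<in> smul.span C"
  using assms(2)
proof (induction rule: smul.span_induct_alt)
  case (step c a x)
  have "a * y \<in> smul.span C"
    using assms(3)
  proof (induction rule: smul.span_induct_alt)
    case (step c' b y)
    then show ?case using assms(1)[OF \<open>a \<in> A\<close>]
      by (auto simp: distrib_left intro!: smul.span_add smul.span_scale)
  qed (simp add: smul.span_zero)
  with step show ?case by (auto simp: distrib_right intro!: smul.span_add smul.span_scale)
qed (simp add: smul.span_zero)

text \<open>Monomials in the generators are indexed by lists, so that \<open>weight\<close> is a
  function of the index and can serve for induction.\<close>

definition gen_prod :: "('i \<Rightarrow> 'i \<Rightarrow> bool) \<Rightarrow> ('i \<times> nat) list \<Rightarrow> ('i, 'k::field) ck" where
  "gen_prod E ws = (\<Prod>(i, n)\<leftarrow>ws. path_sum E i n)"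

abbreviation weight :: "('i \<times> nat) list \<Rightarrow> nat" where
  "weight ws \<equiv> sum_list (map snd ws)"

lemma gen_prod_in_sdse_alg: "gen_prod E ws \<in> graph_sdse_alg E"
  by (induction ws) (auto simp: gen_prod_def one_in_sdse_alg intro: mult_in_sdse_alg path_sum_in_sdse_alg)

lemma gen_prod_append: "gen_prod E (us @ vs) = gen_prod E us * gen_prod E vs"
  by (simp add: gen_prod_def)

lemma sdse_alg_span: "(graph_sdse_alg E :: ('i::finite, 'k::field) ck set) \<subseteq> smul.span (range (gen_prod E))"
  unfolding sdse_alg_def
proof (rule hull_minimal)
  have "(path_sum E i n :: ('i, 'k) ck) = gen_prod E [(i, n)]" for i n by (simp add: gen_prod_def)
  then have "(path_sum E i n :: ('i, 'k) ck) \<in> range (gen_prod E)" for i n by (metis rangeI)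
  then show "sdse_gens (graph_series E) \<subseteq> (smul.span (range (gen_prod E)) :: ('i, 'k) ck set)"
    by (auto simp: sdse_gens_graph_series intro!: smul.span_base)
  have "(1 :: ('i, 'k) ck) = gen_prod E []" by (simp add: gen_prod_def)
  then have "(1 :: ('i, 'k) ck) \<in> smul.span (range (gen_prod E))" by (metis rangeI smul.span_base)
  moreover have "x * y \<in> smul.span (range (gen_prod E))"
    if "x \<in> smul.span (range (gen_prod E))" "y \<in> smul.span (range (gen_prod E))" for x y :: "('i, 'k) ck"
    using that(1,2)
    by (rule span_mult_closed[rotated]) (auto simp flip: gen_prod_append intro: smul.span_base)
  ultimately show "subalgebra (smul.span (range (gen_prod E)) :: ('i, 'k) ck set)"
    by (simp add: subalgebra_def)
qed

text \<open>The part of \<open>B \<otimes> B\<close> on which an antipode is controlled by its values in lower degree.\<close>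

definition lower_tensors :: "('i::finite \<Rightarrow> 'i \<Rightarrow> bool) \<Rightarrow> nat \<Rightarrow> ('i, 'k::field) ck2 set" where
  "lower_tensors E d =
    smul.span {tensor (gen_prod E us) v |us v. weight us < d \<and> v \<in> graph_sdse_alg E}"

lemma lower_tensors_base:
  "weight us < d \<Longrightarrow> v \<in> graph_sdse_alg E \<Longrightarrow> tensor (gen_prod E us) v \<in> lower_tensors E d"
  unfolding lower_tensors_def by (rule smul.span_base) blast

text \<open>Weights at most \<open>a\<close> and at most \<open>b\<close> add up to at most
  \<open>a + b\<close>; the successors turn the strict bounds of \<open>lower_tensors\<close> into
  these.\<close>

lemma lower_tensors_mult:
  assumes "x \<in> lower_tensors E (Suc a)" "y \<in> lower_tensors E (Suc b)"
  shows "x * y \<in> lower_tensors E (Suc (a + b))"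
  unfolding lower_tensors_def
proof (rule span_mult_closed[OF _ assms[unfolded lower_tensors_def]])
  fix x y :: "('a, 'b) ck2"
  assume "x \<in> {tensor (gen_prod E us) v |us v. weight us < Suc a \<and> v \<in> graph_sdse_alg E}"
    "y \<in> {tensor (gen_prod E us) v |us v. weight us < Suc b \<and> v \<in> graph_sdse_alg E}"
  then obtain us v us' v' where x: "x = tensor (gen_prod E us) v" "weight us < Suc a" "v \<in> graph_sdse_alg E"
    and y: "y = tensor (gen_prod E us') v'" "weight us' < Suc b" "v' \<in> graph_sdse_alg E" by blast
  have "x * y = tensor (gen_prod E (us @ us')) (v * v')"
    by (simp add: x y tensor_mult gen_prod_append)
  moreover have "\<dots> \<in> lower_tensors E (Suc (a + b))"
    using x y by (intro lower_tensors_base mult_in_sdse_alg) simp_all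
  ultimately show "x * y \<in> smul.span {tensor (gen_prod E us) v |us v. weight us < Suc (a + b) \<and> v \<in> graph_sdse_alg E}"
    by (simp add: lower_tensors_def)
qed

lemma lower_tensors_mono: "x \<in> lower_tensors E a \<Longrightarrow> a \<le> b \<Longrightarrow> x \<in> lower_tensors E b"
  unfolding lower_tensors_def by (erule smul.span_mono[THEN subsetD, rotated]) (auto intro: less_le_trans)

lemma lower_tensors_subset: "lower_tensors E d \<subseteq> subspace_tensor (graph_sdse_alg E) (graph_sdse_alg E)"
  unfolding lower_tensors_def subspace_tensor_def
  by (rule smul.span_mono) (use gen_prod_in_sdse_alg in blast)

context uniform_graph
begin

text \<open>By \<open>last_path_edge_iff\<close> the condition joining the two parts involves only
  \<open>i\<close>, \<open>k\<close> and the first vertex of the lower part. The parts therefore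
  vary independently, which is what lets the coproduct of X_i(n) be written in the X_j(m)
  again.\<close>

lemma paths_split:
  assumes "1 \<le> k" "k < n"
  shows "bij_betw (\<lambda>p. (drop k p, take k p)) (paths E i n)
    ((\<Union>j\<in>{j. (E ^^ k) i j}. paths E j (n - k)) \<times> paths E i k)"
proof (rule bij_betw_byWitness[where f' = "\<lambda>(q, p). p @ q"])
  have split: "p @ q \<in> paths E i n \<longleftrightarrow> (E ^^ k) i (hd q) \<and> q \<in> paths E (hd q) (n - k) \<and> p \<in> paths E i k"
    if "length p = k" "p \<noteq> []" "q \<noteq> []" for p q
    using that append_in_paths[of p q E i n] assms last_path_edge_iff[of p i k "hd q"] by auto
  show "(\<lambda>p. (drop k p, take k p)) ` paths E i n \<subseteq>
      (\<Union>j\<in>{j. (E ^^ k) i j}. paths E j (n - k)) \<times> paths E i k"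
  proof (intro subsetI, elim imageE)
    fix x p assume p: "p \<in> paths E i n" and x: "x = (drop k p, take k p)"
    have "take k p \<noteq> []" "drop k p \<noteq> []" "length (take k p) = k"
      using p assms by (auto simp: paths_def)
    from split[OF this(3,1,2)] p
    have "(E ^^ k) i (hd (drop k p))" "drop k p \<in> paths E (hd (drop k p)) (n - k)" "take k p \<in> paths E i k"
      by simp_all
    then show "x \<in> (\<Union>j\<in>{j. (E ^^ k) i j}. paths E j (n - k)) \<times> paths E i k"
      unfolding x by blast
  qed
  show "(\<lambda>(q, p). p @ q) ` ((\<Union>j\<in>{j. (E ^^ k) i j}. paths E j (n - k)) \<times> paths E i k) \<subseteq> paths E i n"
  proof (clarify)
    fix j q p assume "(E ^^ k) i j" "q \<in> paths E j (n - k)" "p \<in> paths E i k"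
    then show "p @ q \<in> paths E i n" using split[of p q] by (auto simp: paths_def)
  qed
qed (auto simp: paths_def)

lemma coprod_path_sum_uniform:
  assumes "n \<ge> 1"
  shows "coprod (path_sum E i n :: ('i, 'k::field) ck) = tensor (path_sum E i n) 1 + tensor 1 (path_sum E i n) +
    (\<Sum>k\<in>{1..<n}. tensor (\<Sum>j\<in>{j. (E ^^ k) i j}. path_sum E j (n - k)) (path_sum E i k))"
    (is "_ = ?l + ?r + (\<Sum>k\<in>_. ?m k)")
proof -
  \<comment> \<open>\<open>?b k\<close> collects the terms of all ladders cut after \<open>k\<close>
    vertices. For \<open>0 < k < n\<close> the product structure of the paths makes it a tensor; the
    two ends are the trivial terms.\<close>
  let ?b = "\<lambda>k. \<Sum>p\<in>paths E i n. basis_vec (ladder (drop k p), ladder (take k p)) :: ('i, 'k) ck2"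
  have one: "(1 :: ('i, 'k) ck) = basis_vec (ladder [])" by (simp flip: single_one)
  have "?b k = ?m k" if k: "k \<in> {1..<n}" for k
  proof -
    have "?m k = (\<Sum>j\<in>{j. (E ^^ k) i j}. \<Sum>q\<in>paths E j (n - k). \<Sum>p\<in>paths E i k. basis_vec (ladder q, ladder p))"
      by (simp add: path_sum_def tensor_sum_left) (simp add: tensor_sum_right)
    also have "\<dots> = (\<Sum>q\<in>(\<Union>j\<in>{j. (E ^^ k) i j}. paths E j (n - k)). \<Sum>p\<in>paths E i k. basis_vec (ladder q, ladder p))"
      by (rule sum.UNION_disjoint[symmetric]) (auto dest: paths_disjoint)
    also have "\<dots> = (\<Sum>(q, p)\<in>(\<Union>j\<in>{j. (E ^^ k) i j}. paths E j (n - k)) \<times> paths E i k. basis_vec (ladder q, ladder p))"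
      by (rule sum.cartesian_product)
    also have "\<dots> = ?b k"
      using sum.reindex_bij_betw[OF paths_split[of k n i], of "\<lambda>(q, p). basis_vec (ladder q, ladder p) :: ('i, 'k) ck2"] k
      by (simp add: split_def)
    finally show ?thesis by simp
  qed
  moreover have "?b 0 = ?l"
    by (simp add: path_sum_def tensor_sum_left one del: ladder.simps)
  moreover have "?b n = ?r"
    by (simp add: path_sum_def tensor_sum_right one del: ladder.simps) (simp add: paths_def)
  moreover have "coprod (path_sum E i n) = (\<Sum>k\<le>n. ?b k)"
    unfolding coprod_path_sum by (rule sum.swap)
  moreover have "{..n} = insert 0 (insert n {1..<n})" using assms by auto
  ultimately show ?thesis using assms by simp
qed

text \<open>Induction over the factors: each coproduct is its leading term plus a remainder of lower
  weight on the left, and every term of the expanded product other than the leading one contains a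
  remainder. The antipode is controlled by this triangular shape.\<close>

lemma coprod_gen_prod:
  "coprod (gen_prod E ws :: ('i, 'k::field) ck) - tensor (gen_prod E ws) 1 \<in> lower_tensors E (weight ws)"
proof (induction ws)
  case Nil
  then show ?case by (simp add: gen_prod_def tensor_one lower_tensors_def smul.span_zero)
next
  case (Cons w ws)
  obtain i n where w: "w = (i, n)" by fastforce
  show ?case
  proof (cases n)
    \<comment> \<open>The generator of index 0 is zero, so the whole monomial vanishes.\<close>
    case 0
    then show ?thesis by (simp add: w gen_prod_def lower_tensors_def smul.span_zero)
  next
    case (Suc m)
    let ?X = "path_sum E i n :: ('i, 'k) ck" and ?M = "gen_prod E ws :: ('i, 'k) ck"
    have X: "?X = gen_prod E [(i, n)]" by (simp add: gen_prod_def)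
    have XM: "gen_prod E (w # ws) = ?X * ?M" by (simp add: gen_prod_def w)
    define \<delta> where "\<delta> = coprod ?X - tensor ?X 1"
    define \<delta>' where "\<delta>' = coprod ?M - tensor ?M 1"
    have \<delta>: "\<delta> \<in> lower_tensors E n"
    proof -
      have 1: "\<delta> = tensor (gen_prod E []) ?X +
          (\<Sum>k\<in>{1..<n}. \<Sum>j\<in>{j. (E ^^ k) i j}. tensor (gen_prod E [(j, n - k)]) (path_sum E i k))"
        using Suc by (simp add: \<delta>_def coprod_path_sum_uniform tensor_sum_left gen_prod_def)
      have 2: "tensor (gen_prod E []) ?X \<in> lower_tensors E n"
        using Suc by (intro lower_tensors_base path_sum_in_sdse_alg) simp
      have 3: "(\<Sum>k\<in>{1..<n}. \<Sum>j\<in>{j. (E ^^ k) i j}. tensor (gen_prod E [(j, n - k)]) (path_sum E i k)) \<in> lower_tensors E n"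
        unfolding lower_tensors_def
        by (intro smul.span_sum, fold lower_tensors_def, intro lower_tensors_base path_sum_in_sdse_alg) auto
      show ?thesis unfolding 1 using 2 3 unfolding lower_tensors_def by (rule smul.span_add)
    qed
    have a: "tensor ?X 1 \<in> lower_tensors E (Suc n)"
      unfolding X by (intro lower_tensors_base one_in_sdse_alg) simp
    have b: "tensor ?M 1 \<in> lower_tensors E (Suc (weight ws))"
      by (intro lower_tensors_base one_in_sdse_alg) simp
    have eq: "coprod (gen_prod E (w # ws)) - tensor (gen_prod E (w # ws)) 1 =
        tensor ?X 1 * \<delta>' + (\<delta> * tensor ?M 1 + \<delta> * \<delta>')"
    proof -
      have XM1: "tensor (?X * ?M) 1 = tensor ?X 1 * tensor ?M 1" by (simp add: tensor_mult)
      show ?thesis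
        by (simp only: XM \<delta>_def \<delta>'_def coprod_mult XM1 left_diff_distrib right_diff_distrib) simp
    qed
    have 1: "\<delta> * tensor ?M 1 \<in> lower_tensors E (weight (w # ws))"
      using lower_tensors_mult[OF \<delta>[unfolded Suc] b] by (simp add: w Suc)
    have 2: "tensor ?X 1 * \<delta>' \<in> lower_tensors E (weight (w # ws))"
      and 3: "\<delta> * \<delta>' \<in> lower_tensors E (weight (w # ws))"
    proof -
      have \<delta>': "\<delta>' \<in> lower_tensors E (weight ws)" using Cons.IH by (simp add: \<delta>'_def)
      show "tensor ?X 1 * \<delta>' \<in> lower_tensors E (weight (w # ws))"
      proof (cases "weight ws")
        \<comment> \<open>\<open>lower_tensors E 0\<close> is the zero space because no weight is
          below 0; the product rule applies to successors only.\<close>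
        case 0
        with \<delta>' have "\<delta>' = 0" by (simp add: lower_tensors_def)
        then show ?thesis by (simp add: lower_tensors_def smul.span_zero)
      next
        case (Suc d)
        with lower_tensors_mult[OF a \<delta>'[unfolded Suc]] show ?thesis by (simp add: w)
      qed
      have "\<delta> * \<delta>' \<in> lower_tensors E (Suc (m + weight ws))"
        by (rule lower_tensors_mult[OF \<delta>[unfolded Suc] lower_tensors_mono[OF \<delta>']]) simp
      then show "\<delta> * \<delta>' \<in> lower_tensors E (weight (w # ws))" by (simp add: w Suc)
    qed
    show ?thesis unfolding eq
      using 1 2 3 unfolding lower_tensors_def by (intro smul.span_add)
  qed
qed

text \<open>Applying \<open>S\<close> to the left factors of the coproduct of a monomial x and
  multiplying gives counit(x) 1. The leading term contributes S(x), and the others involve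
  \<open>S\<close> on lower weight only, so S(x) lies in the algebra by induction on the
  weight.\<close>

lemma antipode_sdse_alg:
  fixes S :: "('i, 'k::field) ck \<Rightarrow> ('i, 'k) ck"
  assumes "is_antipode S"
  shows "S ` graph_sdse_alg E \<subseteq> graph_sdse_alg E"
proof -
  let ?B = "graph_sdse_alg E :: ('i, 'k) ck set"
  interpret S: Vector_Spaces.linear smul smul S using assms by (simp add: is_antipode_def)
  \<comment> \<open>\<open>T\<close> is m \<circ> (S \<otimes> id), so \<open>T (coprod x)\<close>
    is the convolution of \<open>S\<close> with the identity.\<close>
  define T :: "('i, 'k) ck2 \<Rightarrow> ('i, 'k) ck" where "T = lin_ext (\<lambda>(F, G). S (basis_vec F) * basis_vec G)"
  have T: "T (tensor u v) = S u * v" for u v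
  proof (induction u rule: basis_induct)
    case (basis F)
    show ?case
      by (induction v rule: basis_induct) (simp_all add: T_def distrib_left)
  qed (simp_all add: T_def S.add S.scale S.zero distrib_right)
  have T_linear: "T (x + y) = T x + T y" "T (smul c x) = smul c (T x)" for x y c
    by (simp_all add: T_def)
  have conv: "T (coprod x) = smul (counit x) 1" for x
    using assms by (simp add: is_antipode_def convolution_def T_def)
  have mon: "S (gen_prod E ws) \<in> ?B" for ws
  proof (induction "weight ws" arbitrary: ws rule: less_induct)
    case less
    let ?x = "gen_prod E ws"
    have "T z \<in> ?B" if "z \<in> lower_tensors E (weight ws)" for z
      using that unfolding lower_tensors_def
    proof (induction rule: smul.span_induct_alt)
      case base
      then show ?case by (simp add: T_def smul.subspace_0[OF subspace_sdse_alg])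
    next
      case (step c x y)
      then obtain us v where "x = tensor (gen_prod E us) v" "weight us < weight ws" "v \<in> ?B" by blast
      with less step show ?case
        by (auto simp: T_linear T mult_in_sdse_alg
            intro!: smul.subspace_add[OF subspace_sdse_alg] smul.subspace_scale[OF subspace_sdse_alg])
    qed
    from this[OF coprod_gen_prod] have "T (coprod ?x - tensor ?x 1) \<in> ?B" .
    moreover have "T (coprod ?x - tensor ?x 1) = smul (counit ?x) 1 - S ?x"
      using conv[of ?x] T[of ?x 1] by (simp add: T_def)
    ultimately have 1: "smul (counit ?x) 1 - S ?x \<in> ?B" by simp
    have "smul (counit ?x) 1 \<in> ?B"
      by (intro smul.subspace_scale[OF subspace_sdse_alg] one_in_sdse_alg)
    from smul.subspace_diff[OF subspace_sdse_alg this 1]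
    show ?case by simp
  qed
  show ?thesis
  proof (rule image_subsetI)
    fix x assume "x \<in> ?B"
    then have "x \<in> smul.span (range (gen_prod E))" using sdse_alg_span by blast
    then show "S x \<in> ?B"
    proof (induction rule: smul.span_induct_alt)
      case base
      then show ?case by (simp add: S.zero smul.subspace_0[OF subspace_sdse_alg])
    next
      case (step c x y)
      then show ?case using mon
        by (auto simp: S.add S.scale
            intro!: smul.subspace_add[OF subspace_sdse_alg] smul.subspace_scale[OF subspace_sdse_alg])
    qed
  qed
qed

lemma coprod_sdse_alg:
  assumes "x \<in> graph_sdse_alg E"
  shows "coprod x \<in> subspace_tensor (graph_sdse_alg E) (graph_sdse_alg E)" (is "_ \<in> ?T")
proof -
  have T: "smul.subspace ?T" by (simp add: subspace_tensor_def)
  from assms have "x \<in> smul.span (range (gen_prod E))" using sdse_alg_span by blast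
  then show ?thesis
  proof (induction rule: smul.span_induct_alt)
    case base
    then show ?case using T by (simp add: smul.subspace_0)
  next
    case (step c x y)
    then obtain ws where ws: "x = gen_prod E ws" by blast
    have "coprod x - tensor x 1 \<in> ?T"
      using coprod_gen_prod[of ws] lower_tensors_subset by (auto simp: ws)
    moreover have "tensor x 1 \<in> ?T"
      unfolding subspace_tensor_def ws
      by (rule smul.span_base) (use gen_prod_in_sdse_alg one_in_sdse_alg in blast)
    ultimately have "coprod x - tensor x 1 + tensor x 1 \<in> ?T" by (rule smul.subspace_add[OF T])
    with step show ?case
      by (auto intro!: smul.subspace_add[OF T] smul.subspace_scale[OF T])
  qed
qed

lemma hopf_sdse_graph_series: "hopf_sdse (graph_series E)"
  using coprod_sdse_alg antipode_sdse_alg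
  by (auto simp: hopf_sdse_def hopf_subalgebra_def subalgebra_sdse_alg)

end

subsection \<open>The pre-Lie algebra\<close>

lemma homogeneous_path_sum: "path_sum E i n \<in> homogeneous n"
  unfolding path_sum_def
  by (intro homogeneous_sum) (auto simp: homogeneous_def paths_def)

lemma lookup_ladder_homogeneous:
  "x \<in> homogeneous n \<Longrightarrow> length p \<noteq> n \<Longrightarrow> Poly_Mapping.lookup x (ladder p) = 0"
  unfolding homogeneous_def by (metis (mono_tags, lifting) forest_deg_ladder in_keys_iff mem_Collect_eq)

lemma primitivesD:
  assumes "f \<in> primitives B"
  shows "x \<notin> B \<Longrightarrow> f x = 0"
    and "x \<in> B \<Longrightarrow> y \<in> B \<Longrightarrow> f (x + y) = f x + f y"
    and "x \<in> B \<Longrightarrow> f (smul c x) = c * f x"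
    and "x \<in> B \<Longrightarrow> y \<in> B \<Longrightarrow> f (x * y) = f x * counit y + counit x * f y"
  using assms by (auto simp: primitives_def graded_dual_def)

text \<open>A primitive form on a product is determined by its values on the factors, so two of them
  agree on a subalgebra; it contains the generators. Outside the algebra both are 0 by
  convention.\<close>

lemma primitives_eqI:
  fixes E :: "'i::finite \<Rightarrow> 'i \<Rightarrow> bool"
  assumes f: "f \<in> primitives (graph_sdse_alg E :: ('i, 'k::field) ck set)"
    and g: "g \<in> primitives (graph_sdse_alg E)"
    and eq: "\<And>i n. n \<ge> 1 \<Longrightarrow> f (path_sum E i n) = g (path_sum E i n)"
  shows "f = g"
proof -
  let ?B = "graph_sdse_alg E :: ('i, 'k) ck set"
  note B = subspace_sdse_alg[of "graph_series E :: 'i \<Rightarrow> ('i, 'k) mseries"]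
    one_in_sdse_alg[of "graph_series E :: 'i \<Rightarrow> ('i, 'k) mseries"]
  \<comment> \<open>Primitivity at \<open>1 * 1\<close> reads
    \<open>f 1 = f 1 + f 1\<close>.\<close>
  have "f 1 = 0" "g 1 = 0"
    using primitivesD(4)[OF f B(2) B(2)] primitivesD(4)[OF g B(2) B(2)]
    by (metis add_cancel_right_right counit_one mult_1 mult.right_neutral)+
  moreover have "f 0 = 0" "g 0 = 0"
    using primitivesD(3)[OF f B(2), of 0] primitivesD(3)[OF g B(2), of 0] by simp_all
  ultimately have "subalgebra {x \<in> ?B. f x = g x}"
    using B by (auto simp: subalgebra_def smul.subspace_def primitivesD[OF f] primitivesD[OF g] mult_in_sdse_alg)
  moreover have "sdse_gens (graph_series E) \<subseteq> {x \<in> ?B. f x = g x}"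
    by (auto simp: sdse_gens_graph_series eq path_sum_in_sdse_alg)
  ultimately have "?B \<subseteq> {x \<in> ?B. f x = g x}"
    by (subst (1) sdse_alg_def) (rule hull_minimal)
  then show ?thesis using primitivesD(1)[OF f] primitivesD(1)[OF g] by (intro ext) fastforce
qed

lemma tensor_in_subspace_tensor: "u \<in> U \<Longrightarrow> v \<in> V \<Longrightarrow> tensor u v \<in> subspace_tensor U V"
  unfolding subspace_tensor_def by (rule smul.span_base) blast

text \<open>Scalars are absorbed into the left factors. This provides the presentation that
  \<open>tensor_form\<close> asks for.\<close>

lemma subspace_tensor_sum_list:
  assumes "smul.subspace U" "z \<in> subspace_tensor U V"
  shows "\<exists>ps. set ps \<subseteq> U \<times> V \<and> z = (\<Sum>(u, v)\<leftarrow>ps. tensor u v)"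
  using assms(2) unfolding subspace_tensor_def
proof (induction rule: smul.span_induct_alt)
  case base
  show ?case by (rule exI[of _ "[]"]) simp
next
  case (step c x y)
  then obtain u v ps where "x = tensor u v" "u \<in> U" "v \<in> V"
    "set ps \<subseteq> U \<times> V" "y = (\<Sum>(u, v)\<leftarrow>ps. tensor u v)" by blast
  then show ?case
    by (intro exI[of _ "(smul c u, v) # ps"]) (auto intro: smul.subspace_scale[OF assms(1)])
qed

lemma tree_proj_linear [simp]:
  "tree_proj 0 = 0" "tree_proj (x + y) = tree_proj x + tree_proj y"
  "tree_proj (smul c x) = smul c (tree_proj x)" "tree_proj (sum f S) = (\<Sum>s\<in>S. tree_proj (f s))"
  by (simp_all add: tree_proj_def)

lemma tree_proj_one [simp]: "tree_proj 1 = 0"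
  by (simp add: tree_proj_def flip: single_one)

lemma tree_proj_path_sum [simp]: "tree_proj (path_sum E i n) = path_sum E i n"
  unfolding path_sum_def tree_proj_linear
  by (intro sum.cong refl) (auto simp: tree_proj_def dest: paths_not_Nil)

lemma tensor_map_tree_proj [simp]:
  "tensor_map tree_proj tree_proj (tensor u v) = tensor (tree_proj u) (tree_proj v)"
proof (induction u rule: basis_induct)
  case (basis F)
  show ?case by (induction v rule: basis_induct) (simp_all add: tensor_map_def)
qed (simp_all add: tensor_map_def)

lemma tensor_map_linear [simp]:
  "tensor_map f g 0 = 0" "tensor_map f g (x + y) = tensor_map f g x + tensor_map f g y"
  "tensor_map f g (smul c x) = smul c (tensor_map f g x)"
  "tensor_map f g (sum h S) = (\<Sum>s\<in>S. tensor_map f g (h s))"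
  by (simp_all add: tensor_map_def)

section \<open>The dual basis of the X_i(n) and its pre-Lie product\<close>

context uniform_graph
begin

text \<open>
  The ladder of \<open>some_path E (i, n)\<close> occurs in \<open>X\<^sub>i(n)\<close> with coefficient 1 and in no other \<open>X\<^sub>j(m)\<close>,
  so its coefficient functional restricts to the primitive element dual to \<open>X\<^sub>i(n)\<close>.
\<close>

definition ladder_form :: "('i \<times> nat \<Rightarrow>\<^sub>0 'k::field) \<Rightarrow> ('i, 'k) ck \<Rightarrow> 'k" where
  "ladder_form m x = (\<Sum>v\<in>Poly_Mapping.keys m.
     Poly_Mapping.lookup m v * Poly_Mapping.lookup x (ladder (some_path E v)))"

definition dual_form :: "('i \<times> nat \<Rightarrow>\<^sub>0 'k::field) \<Rightarrow> ('i, 'k) ck \<Rightarrow> 'k" where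
  "dual_form m x = (if x \<in> graph_sdse_alg E then ladder_form m x else 0)"

lemma ladder_form_superset:
  assumes "finite S" "Poly_Mapping.keys m \<subseteq> S"
  shows "ladder_form m x = (\<Sum>v\<in>S. Poly_Mapping.lookup m v * Poly_Mapping.lookup x (ladder (some_path E v)))"
  unfolding ladder_form_def using assms by (intro sum.mono_neutral_left) (auto simp: in_keys_iff)

lemma ladder_form_linear:
  "ladder_form m 0 = 0" "ladder_form m (x + y) = ladder_form m x + ladder_form m y"
  "ladder_form m (smul c x) = c * ladder_form m x"
  by (simp_all add: ladder_form_def lookup_add distrib_left sum.distrib sum_distrib_left mult.left_commute)

lemma ladder_form_linear_left:
  "ladder_form 0 x = 0" "ladder_form (m + m') x = ladder_form m x + ladder_form m' x"
  "ladder_form (smul c m) x = c * ladder_form m x"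
proof -
  let ?S = "Poly_Mapping.keys m \<union> Poly_Mapping.keys m'"
  have "Poly_Mapping.keys (m + m') \<subseteq> ?S" "Poly_Mapping.keys (smul c m) \<subseteq> ?S"
    using Poly_Mapping.keys_add[of m m'] by (auto simp: in_keys_iff)
  then show "ladder_form (m + m') x = ladder_form m x + ladder_form m' x"
    "ladder_form (smul c m) x = c * ladder_form m x"
    by (simp_all add: ladder_form_superset[of ?S] lookup_add distrib_right sum.distrib sum_distrib_left mult.assoc)
qed (simp add: ladder_form_def)

lemma lookup_path_sum_some_path:
  assumes "q \<ge> 1"
  shows "Poly_Mapping.lookup (path_sum E i n) (ladder (some_path E (j, q))) = (if (j, q) = (i, n) then 1 else 0)"
proof -
  have "some_path E (j, q) \<in> paths E j q" using assms by (rule some_path_in)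
  then have "some_path E (j, q) \<in> paths E i n \<longleftrightarrow> (j, q) = (i, n)" by (auto simp: paths_def)
  then show ?thesis by (simp add: lookup_path_sum)
qed

lemma ladder_form_path_sum:
  assumes "m \<in> model"
  shows "ladder_form m (path_sum E i n) = Poly_Mapping.lookup m (i, n)"
proof -
  have "ladder_form m (path_sum E i n) = (\<Sum>v\<in>Poly_Mapping.keys m. if v = (i, n) then Poly_Mapping.lookup m v else 0)"
    unfolding ladder_form_def
  proof (rule sum.cong[OF refl])
    fix v assume "v \<in> Poly_Mapping.keys m"
    with assms obtain j q where "v = (j, q)" "q \<ge> 1" by (auto simp: model_def)
    then show "Poly_Mapping.lookup m v * Poly_Mapping.lookup (path_sum E i n) (ladder (some_path E v)) =
        (if v = (i, n) then Poly_Mapping.lookup m v else 0)"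
      by (simp only: lookup_path_sum_some_path) simp
  qed
  then show ?thesis by (simp add: sum.delta in_keys_iff)
qed

lemma dual_form_path_sum:
  "m \<in> model \<Longrightarrow> dual_form m (path_sum E i n) = Poly_Mapping.lookup m (i, n)"
  by (simp add: dual_form_def path_sum_in_sdse_alg ladder_form_path_sum)

text \<open>Coefficients of non-empty ladders are infinitesimal characters, and a finite combination
  of them sees only finitely many degrees.\<close>

lemma dual_form_primitive:
  fixes m :: "'i \<times> nat \<Rightarrow>\<^sub>0 'k::field"
  assumes "m \<in> model"
  shows "dual_form m \<in> primitives (graph_sdse_alg E)"
proof -
  let ?B = "graph_sdse_alg E :: ('i, 'k) ck set"
  have path: "length (some_path E v) = snd v" "some_path E v \<noteq> []" if "v \<in> Poly_Mapping.keys m" for v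
    using that assms some_path_in[of "snd v" "fst v"] by (auto simp: model_def paths_def)
  obtain N where N: "\<And>v. v \<in> Poly_Mapping.keys m \<Longrightarrow> snd v < N"
    using finite_nat_set_iff_bounded[of "snd ` Poly_Mapping.keys m"] by auto
  have "ladder_form m x = 0" if "n \<ge> N" "x \<in> homogeneous n" for n x
    unfolding ladder_form_def
  proof (intro sum.neutral ballI)
    fix v assume v: "v \<in> Poly_Mapping.keys m"
    with N[OF v] path[OF v] that
    show "Poly_Mapping.lookup m v * Poly_Mapping.lookup x (ladder (some_path E v)) = 0"
      by (simp add: lookup_ladder_homogeneous)
  qed
  then have "\<exists>N. \<forall>n\<ge>N. \<forall>x\<in>?B \<inter> homogeneous n. dual_form m x = 0"
    by (auto simp: dual_form_def)
  moreover have "ladder_form m (x * y) = ladder_form m x * counit y + counit x * ladder_form m y" for x y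
    unfolding ladder_form_def sum_distrib_left sum_distrib_right sum.distrib[symmetric]
    by (intro sum.cong refl) (simp add: lookup_mult_ladder path algebra_simps)
  moreover have "x + y \<in> ?B" "smul c x \<in> ?B" if "x \<in> ?B" "y \<in> ?B" for x y c
    using that by (auto intro: smul.subspace_add[OF subspace_sdse_alg] smul.subspace_scale[OF subspace_sdse_alg])
  ultimately show ?thesis
    by (simp add: primitives_def graded_dual_def dual_form_def ladder_form_linear mult_in_sdse_alg)
qed

text \<open>A form in the graded dual vanishes in high degrees and there are finitely many vertices,
  so only finitely many values f(X_i(n)) are non-zero. These values are the coordinates
  \<open>m\<close>.\<close>

lemma primitive_imp_dual_form:
  assumes f: "f \<in> primitives (graph_sdse_alg E :: ('i, 'k::field) ck set)"
  shows "\<exists>m\<in>model. f = dual_form m"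
proof -
  let ?B = "graph_sdse_alg E :: ('i, 'k) ck set"
  obtain N where N: "\<And>n x. n \<ge> N \<Longrightarrow> x \<in> ?B \<Longrightarrow> x \<in> homogeneous n \<Longrightarrow> f x = 0"
    using f unfolding primitives_def graded_dual_def by blast
  have "{v. f (case v of (i, n) \<Rightarrow> path_sum E i n) \<noteq> 0} \<subseteq> UNIV \<times> {..<N}"
    using N[OF _ path_sum_in_sdse_alg homogeneous_path_sum] by (fastforce simp: not_le[symmetric])
  then have fin: "finite {v. f (case v of (i, n) \<Rightarrow> path_sum E i n) \<noteq> 0}"
    by (rule finite_subset) simp
  define m where "m = Abs_poly_mapping (\<lambda>v. f (case v of (i, n) \<Rightarrow> path_sum E i n))"
  have lookup: "Poly_Mapping.lookup m (i, n) = f (path_sum E i n)" for i n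
    using fin by (simp add: m_def Abs_poly_mapping_inverse)
  have "f 0 = 0" using primitivesD(3)[OF f one_in_sdse_alg, of 0] by simp
  \<comment> \<open>Index 0 does not occur in \<open>m\<close>, since X_i(0) = 0.\<close>
  then have "m \<in> model"
    by (auto simp: model_def in_keys_iff lookup) (metis not_less_eq_eq path_sum_0 le_zero_eq)
  moreover have "f = dual_form m"
    using \<open>m \<in> model\<close>
    by (intro primitives_eqI[OF f dual_form_primitive]) (simp_all add: dual_form_path_sum lookup)
  ultimately show ?thesis by blast
qed

lemma dual_form_image: "dual_form ` model = primitives (graph_sdse_alg E)"
  using dual_form_primitive primitive_imp_dual_form by blast

lemma dual_form_eq_iff:
  assumes "a \<in> model" "b \<in> model"
  shows "dual_form a = dual_form b \<longleftrightarrow> a = b"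
proof
  assume "dual_form a = dual_form b"
  then have "Poly_Mapping.lookup a (i, n) = Poly_Mapping.lookup b (i, n)" for i n
    using assms by (metis dual_form_path_sum)
  then show "a = b" by (intro poly_mapping_eqI) auto
qed simp

text \<open>Lifting \<open>a\<close> and \<open>b\<close> to the free algebra exhibits their product
  as a normal form.\<close>

lemma basis_mult_model:
  assumes "a \<in> model" "b \<in> model"
  shows "bilin_ext (basis_mult E) a b \<in> model"
proof -
  have "bilin_ext (basis_mult E) a b = normal_form E (representative E a * representative E b)"
    using assms by (simp add: normal_form_mult representative_free_nu normal_form_representative)
  then show ?thesis by (simp add: normal_form_in_model)
qed

text \<open>The index sets are those of \<open>coprod_path_sum_uniform\<close>: \<open>k\<close>
  vertices stay with the root \<open>i\<close>, and \<open>j\<close> is the root of the part cut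
  off. The product is thus dual to the middle part of the coproduct.\<close>

lemma lookup_basis_mult:
  fixes a b :: "'i \<times> nat \<Rightarrow>\<^sub>0 'k::field"
  assumes "a \<in> model" "b \<in> model"
  shows "Poly_Mapping.lookup (bilin_ext (basis_mult E) a b) (i, n) =
    (\<Sum>k\<in>{1..<n}. \<Sum>j\<in>{j. (E ^^ k) i j}. Poly_Mapping.lookup a (j, n - k) * Poly_Mapping.lookup b (i, k))"
  using assms(1)[unfolded model_def, THEN CollectD]
proof (induction a rule: basis_induct_on)
  case (basis v)
  then obtain j' q where v: "v = (j', q)" "q \<ge> 1" by auto
  from assms(2)[unfolded model_def, THEN CollectD] show ?case
  proof (induction b rule: basis_induct_on)
    case (basis w)
    then obtain i' m where w: "w = (i', m)" "m \<ge> 1" by auto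
    have inner: "(\<Sum>j\<in>{j. (E ^^ k) i j}. Poly_Mapping.lookup (basis_vec v) (j, n - k) * Poly_Mapping.lookup (basis_vec w) (i, k)) =
        (if k = m then if i = i' \<and> n - m = q \<and> (E ^^ m) i j' then 1 else 0 else (0 :: 'k))" for k
    proof -
      have "Poly_Mapping.lookup (basis_vec v) (j, n - k) * Poly_Mapping.lookup (basis_vec w) (i, k) =
          (if j = j' then if n - k = q \<and> i = i' \<and> k = m then 1 else 0 else (0 :: 'k))" for j
        by (auto simp: v w lookup_single when_def)
      then show ?thesis by (auto simp: sum.delta)
    qed
    have "(\<Sum>k\<in>{1..<n}. if k = m then if i = i' \<and> n - m = q \<and> (E ^^ m) i j' then 1 else 0 else (0 :: 'k)) =
        (if i = i' \<and> m + q = n \<and> (E ^^ m) i' j' then 1 else 0)"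
      using v w by (auto simp: sum.delta)
    then show ?case
      unfolding inner by (auto simp: v w basis_mult_def lookup_single when_def)
  qed (simp_all add: lookup_add distrib_left sum.distrib sum_distrib_left mult.left_commute)
qed (simp_all add: lookup_add distrib_right sum.distrib sum_distrib_left mult.assoc)

text \<open>Realizes f \<otimes> g for two dual forms through coefficients on the whole tensor
  square, without reference to a presentation by tensors.\<close>

definition pair_form :: "('i \<times> nat \<Rightarrow>\<^sub>0 'k::field) \<Rightarrow> ('i \<times> nat \<Rightarrow>\<^sub>0 'k) \<Rightarrow> ('i, 'k) ck2 \<Rightarrow> 'k" where
  "pair_form a b z = (\<Sum>v\<in>Poly_Mapping.keys a. \<Sum>w\<in>Poly_Mapping.keys b.
     Poly_Mapping.lookup a v * Poly_Mapping.lookup b w *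
     Poly_Mapping.lookup z (ladder (some_path E v), ladder (some_path E w)))"

lemma pair_form_linear:
  "pair_form a b 0 = 0" "pair_form a b (x + y) = pair_form a b x + pair_form a b y"
  "pair_form a b (smul c x) = c * pair_form a b x"
  by (simp_all add: pair_form_def lookup_add distrib_left sum.distrib sum_distrib_left mult.left_commute)

lemma pair_form_sum: "pair_form a b (sum f S) = (\<Sum>s\<in>S. pair_form a b (f s))"
  by (induction S rule: infinite_finite_induct) (simp_all add: pair_form_linear)

lemma pair_form_tensor: "pair_form a b (tensor u v) = ladder_form a u * ladder_form b v"
  by (simp add: pair_form_def ladder_form_def lookup_tensor sum_product mult.assoc mult.left_commute)

lemma ladder_form_sum: "ladder_form a (sum f S) = (\<Sum>s\<in>S. ladder_form a (f s))"
  by (induction S rule: infinite_finite_induct) (simp_all add: ladder_form_linear)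

text \<open>Every presentation of \<open>z\<close> as a sum of tensors from \<open>B\<close> yields
  the value \<open>pair_form a b z\<close>, so the definite description in
  \<open>tensor_form\<close> is well defined.\<close>

lemma tensor_form_dual_form:
  fixes z :: "('i, 'k::field) ck2"
  defines "B \<equiv> graph_sdse_alg E :: ('i, 'k) ck set"
  assumes z: "z \<in> subspace_tensor B B"
  shows "tensor_form B B (dual_form a) (dual_form b) z = pair_form a b z"
proof -
  have rep: "(\<Sum>(u, v)\<leftarrow>ps. dual_form a u * dual_form b v) = pair_form a b (\<Sum>(u, v)\<leftarrow>ps. tensor u v)"
    if "set ps \<subseteq> B \<times> B" for ps
    using that by (induction ps) (auto simp: pair_form_linear pair_form_tensor dual_form_def B_def)
  obtain ps where "set ps \<subseteq> B \<times> B" "z = (\<Sum>(u, v)\<leftarrow>ps. tensor u v)"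
    using subspace_tensor_sum_list[OF _ z] subspace_sdse_alg by (auto simp: B_def)
  then show ?thesis
    unfolding tensor_form_def
    by (intro the_equality exI[of _ ps]) (auto simp: rep)
qed

text \<open>The right-hand side has the defining property of the star product, because pairing the
  middle terms of the coproduct of X_i(n) reproduces \<open>lookup_basis_mult\<close>; uniqueness is
  \<open>primitives_eqI\<close>.\<close>

lemma sdse_star_dual_form:
  fixes a b :: "'i \<times> nat \<Rightarrow>\<^sub>0 'k::field"
  assumes a: "a \<in> model" and b: "b \<in> model"
  shows "sdse_star (graph_series E) (dual_form a) (dual_form b) = dual_form (bilin_ext (basis_mult E) a b)"
proof -
  let ?B = "graph_sdse_alg E :: ('i, 'k) ck set"
  let ?m = "bilin_ext (basis_mult E) a b"
  let ?z = "\<lambda>x. tensor_map tree_proj tree_proj (coprod x) :: ('i, 'k) ck2"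
  have m: "?m \<in> model" using a b by (rule basis_mult_model)
  have ST: "smul.subspace (subspace_tensor ?B ?B)" by (simp add: subspace_tensor_def)
  have gen: "?z (path_sum E i n) \<in> subspace_tensor ?B ?B"
    "pair_form a b (?z (path_sum E i n)) = ladder_form ?m (path_sum E i n)" if "n \<ge> 1" for i n
  proof -
    \<comment> \<open>The outer terms of the coproduct disappear because
      \<open>tree_proj 1 = 0\<close>.\<close>
    have z: "?z (path_sum E i n) =
        (\<Sum>k\<in>{1..<n}. tensor (\<Sum>j\<in>{j. (E ^^ k) i j}. path_sum E j (n - k)) (path_sum E i k))"
      using that by (simp add: coprod_path_sum_uniform)
    have "tensor (\<Sum>j\<in>{j. (E ^^ k) i j}. path_sum E j (n - k)) (path_sum E i k) \<in> subspace_tensor ?B ?B" for k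
      by (intro tensor_in_subspace_tensor smul.subspace_sum[OF subspace_sdse_alg] path_sum_in_sdse_alg)
    then show "?z (path_sum E i n) \<in> subspace_tensor ?B ?B"
      unfolding z by (intro smul.subspace_sum[OF ST])
    show "pair_form a b (?z (path_sum E i n)) = ladder_form ?m (path_sum E i n)"
      unfolding z pair_form_sum pair_form_tensor ladder_form_sum
      by (simp add: ladder_form_path_sum a b m lookup_basis_mult sum_distrib_right)
  qed
  \<comment> \<open>The memberships are carried along because \<open>tensor_form\<close> is
    evaluated only on the tensor square of the algebra, and \<open>dual_form\<close> agrees with
    \<open>ladder_form\<close> only on the algebra.\<close>
  have span: "?z x \<in> subspace_tensor ?B ?B \<and> pair_form a b (?z x) = ladder_form ?m x \<and> x \<in> ?B"
    if "x \<in> smul.span (sdse_gens (graph_series E))" for x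
    using that
  proof (induction rule: smul.span_induct_alt)
    case base
    then show ?case
      by (simp add: smul.subspace_0[OF ST] smul.subspace_0[OF subspace_sdse_alg] pair_form_linear ladder_form_linear)
  next
    case (step c x y)
    then obtain i n where "x = path_sum E i n" "n \<ge> 1" by (auto simp: sdse_gens_graph_series)
    with step gen[of n i] show ?case
      by (auto simp: pair_form_linear ladder_form_linear path_sum_in_sdse_alg
          intro!: smul.subspace_add[OF ST] smul.subspace_scale[OF ST]
            smul.subspace_add[OF subspace_sdse_alg] smul.subspace_scale[OF subspace_sdse_alg])
  qed
  then have star: "dual_form ?m x = tensor_form ?B ?B (dual_form a) (dual_form b) (?z x)"
    if "x \<in> smul.span (sdse_gens (graph_series E))" for x
    using that by (simp add: tensor_form_dual_form dual_form_def)
  show ?thesis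
    unfolding sdse_star_def
  proof (rule the_equality)
    show "dual_form ?m \<in> primitives ?B \<and> (\<forall>x\<in>smul.span (sdse_gens (graph_series E)).
        dual_form ?m x = tensor_form ?B ?B (dual_form a) (dual_form b) (?z x))"
      using star dual_form_primitive[OF m] by blast
  next
    fix h assume h: "h \<in> primitives ?B \<and> (\<forall>x\<in>smul.span (sdse_gens (graph_series E)).
        h x = tensor_form ?B ?B (dual_form a) (dual_form b) (?z x))"
    show "h = dual_form ?m"
    proof (rule primitives_eqI)
      fix i n assume "(1::nat) \<le> n"
      then have "path_sum E i n \<in> smul.span (sdse_gens (graph_series E) :: ('i, 'k) ck set)"
        by (intro smul.span_base) (auto simp: sdse_gens_graph_series)
      with h star show "h (path_sum E i n) = dual_form ?m (path_sum E i n)" by simp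
    qed (use h dual_form_primitive[OF m] in auto)
  qed
qed

lemma alg_hom_sdse_prelie:
  "alg_hom free_alg (sdse_prelie (graph_series E)) (dual_form \<circ> normal_form E)"
  by (auto simp: alg_hom_def free_alg_def sdse_prelie_def normal_form_in_model dual_form_primitive
      normal_form_mult sdse_star_dual_form dual_form_def ladder_form_linear_left fun_eq_iff)

lemma sdse_prelie_surj:
  "(dual_form \<circ> normal_form E) ` elems free_alg = elems (sdse_prelie (graph_series E))"
  by (simp add: free_alg_def sdse_prelie_def normal_form_surj dual_form_image del: comp_apply flip: image_comp)

lemma nu_algebra_sdse_prelie: "nu_algebra (sdse_prelie (graph_series E))"
  using nu_algebra_free_alg alg_hom_sdse_prelie sdse_prelie_surj by (rule nu_algebra_image)

lemma associative_alg_sdse_prelie: "associative_alg (sdse_prelie (graph_series E))"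
  using nu_algebra_free_alg associative_alg_free_alg alg_hom_sdse_prelie sdse_prelie_surj
  by (rule associative_alg_image)

text \<open>Both algebras are images of the free algebra, and in both two elements have the same
  image exactly when their difference has normal form 0.\<close>

lemma isomorphic_sdse_prelie: "isomorphic_alg (sdse_prelie (graph_series E)) (graph_alg E)"
proof (rule isomorphic_alg_images[OF nu_algebra_free_alg alg_hom_sdse_prelie sdse_prelie_surj])
  show "alg_hom free_alg (graph_alg E) (coset (graph_ideal E))"
    unfolding graph_alg_def by (rule alg_hom_coset[OF graph_relations_subset])
  show "coset (graph_ideal E) ` elems free_alg = elems (graph_alg E)"
    by (simp add: graph_alg_simps) (simp add: free_alg_def)
  fix x y :: "'i list \<Rightarrow>\<^sub>0 'k::field"
  assume "x \<in> elems free_alg" "y \<in> elems free_alg"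
  then have "x - y \<in> free_nu" by (auto simp: free_alg_def)
  from graph_ideal_iff[OF this]
  show "(dual_form \<circ> normal_form E) x = (dual_form \<circ> normal_form E) y \<longleftrightarrow>
      coset (graph_ideal E) x = coset (graph_ideal E) y"
    by (simp add: dual_form_eq_iff normal_form_in_model coset_eq_iff[OF nu_ideal_graph_ideal])
qed

end

section \<open>The equivalences and their consequences\<close>

theorem proposition57:
  fixes E :: "'i::finite \<Rightarrow> 'i \<Rightarrow> bool"
    and A :: "('k::field_char_0, ('i list \<Rightarrow>\<^sub>0 'k) set) nalg"
    and F :: "'i \<Rightarrow> ('i, 'k) mseries"
  assumes A: "A = graph_alg E"
    and F: "F = graph_series E"
  shows
    "let a = is_basis A {(i, n). n \<ge> 1} (\<lambda>(i, n). P E i n);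
         b = (\<forall>i. \<forall>n\<ge>1. P E i n \<noteq> zeroA A);
         c = ((\<forall>i. \<exists>j. E i j) \<and> (\<forall>i j k. E i j \<and> E i k \<longrightarrow> (\<forall>l. E j l \<longleftrightarrow> E k l)));
         d = ((\<forall>i. nonconstant (F i)) \<and> hopf_sdse F)
     in (a \<longleftrightarrow> b) \<and> (b \<longleftrightarrow> c) \<and> (c \<longleftrightarrow> d) \<and>
        (c \<longrightarrow>
           A = presented_alg (quadratic_relations E) \<and>
           (\<forall>i j. \<forall>m\<ge>1. \<forall>n\<ge>1. multA A (P E j n) (P E i m) =
              (if (E ^^ m) i j then P E i (m + n) else zeroA A)) \<and>
           nu_algebra (sdse_prelie F) \<and> associative_alg (sdse_prelie F) \<and>
           isomorphic_alg (sdse_prelie F) A)"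
proof -
  define a where "a = is_basis A {(i, n). n \<ge> 1} (\<lambda>(i, n). P E i n)"
  define b where "b = (\<forall>i. \<forall>n\<ge>1. P E i n \<noteq> zeroA A)"
  define c where "c = ((\<forall>i. \<exists>j. E i j) \<and> (\<forall>i j k. E i j \<and> E i k \<longrightarrow> (\<forall>l. E j l \<longleftrightarrow> E k l)))"
  define d where "d = ((\<forall>i. nonconstant (F i)) \<and> hopf_sdse F)"
  \<comment> \<open>The cycle (a), (b), (c), (a) together with the two implications between (c) and
    (d) gives all equivalences.\<close>
  have ab: "b" if a using that unfolding a_def b_def A by (rule graph_alg_basis_nonzero)
  have bc: "c" if b using that unfolding b_def c_def A by (rule P_nonzero_imp_condition)
  have dc: "c" if d
  proof -
    have "hopf_sdse (graph_series E :: 'i \<Rightarrow> ('i, 'k) mseries)" using that by (simp add: d_def F)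
    note hopf_imp_same_descendants[OF this]
    moreover have "\<forall>i. \<exists>j. E i j" using that by (simp add: d_def F nonconstant_graph_series)
    ultimately show c unfolding c_def by meson
  qed
  have uniform: "uniform_graph E" if c
    using that unfolding c_def uniform_graph_def by meson
  have ca: "a" if c
    using uniform_graph.graph_alg_basis[OF uniform[OF that]] by (simp add: a_def A)
  have cd: "d" if c
    using uniform_graph.hopf_sdse_graph_series[OF uniform[OF that]] uniform_graph.descendant[OF uniform[OF that]]
    by (simp add: d_def F nonconstant_graph_series)
  have rest: "A = presented_alg (quadratic_relations E) \<and>
      (\<forall>i j. \<forall>m\<ge>1. \<forall>n\<ge>1. multA A (P E j n) (P E i m) =
        (if (E ^^ m) i j then P E i (m + n) else zeroA A)) \<and>
      nu_algebra (sdse_prelie F) \<and> associative_alg (sdse_prelie F) \<and> isomorphic_alg (sdse_prelie F) A" if c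
  proof -
    interpret uniform_graph E using that by (rule uniform)
    show ?thesis
      unfolding A F
      by (intro conjI allI impI graph_alg_quadratic P_mult nu_algebra_sdse_prelie
          associative_alg_sdse_prelie isomorphic_sdse_prelie)
  qed
  show ?thesis
    unfolding Let_def a_def[symmetric] b_def[symmetric] c_def[symmetric] d_def[symmetric]
    using ab bc ca cd dc rest by blast
qed

end
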